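(* Let $q,m,k,s_1,\ldots,s_u$ be positive integers such that $q$ is a prime power and $m\leq q$. Assume that there exist a weighing matrix of order $m$ and weight $k$ and an orthogonal design of order $m$ and type $(s_1,\ldots,s_u)$. Then: (1) there exist $m$ mutually unbiased orthogonal designs of order $mq$ and type $(ks_1,\ldots,ks_u)$ with parameter $\alpha=k^2$; (2) for every nonempty subset $S\subseteq\{1,\ldots,u\}$ there exist $m$ mutually quasi-unbiased weighing matrices for the parameters $\left(mq,\;k\sum_{i\in S}s_i,\;k^2,\;(\sum_{i\in S}s_i)^2\right)$.
   Context: A weighing matrix of order $n$ and weight $k$ is an $n\times n$ matrix $W$ with entries in $\{0,1,-1\}$ such that $WW^\top=kI_n$. Let $x_1,\ldots,x_u$ be distinct commuting real indeterminates. An orthogonal design of order $n$ and type $(s_1,\ldots,s_u)$ in the variables $x_1,\ldots,x_u$ is an $n\times n$ matrix $D$ with entries in $\{0,\pm x_1,\ldots,\pm x_u\}$ such that $DD^\top=(s_1x_1^2+\cdots+s_ux_u^2)I_n$. Two orthogonal designs $D_1,D_2$ of order $n$ and type $(s_1,\ldots,s_u)$ in the same variables are unbiased with parameter $\alpha$ if $\alpha$ is a positive real number and there is a $(0,1,-1)$-matrix $W$ with $D_1D_2^\top=\frac{s_1x_1^2+\cdots+s_ux_u^2}{\sqrt{\alpha}}W$; a family is mutually unbiased with parameter $\alpha$ if any two distinct members are. Two weighing matrices $W_1,W_2$ of order $n$ and weight $k$ are quasi-unbiased for parameters $(n,k,l,a)$ if $\frac{1}{\sqrt a}W_1W_2^\top$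 is a weighing matrix of order $n$ and weight $l$; a family is mutually quasi-unbiased for these parameters if any two distinct members are. *)

theory Defs
  imports Complex_Main "HOL-Computational_Algebra.Primes"
begin

text \<open>Square matrices of order n are represented as functions nat => nat => _,
  only the entries with both indices < n being relevant.\<close>

definition weighing_matrix :: "nat \<Rightarrow> nat \<Rightarrow> (nat \<Rightarrow> nat \<Rightarrow> real) \<Rightarrow> bool" where
  "weighing_matrix n k W \<longleftrightarrow>
     (\<forall>i<n. \<forall>j<n. W i j \<in> {-1, 0, 1}) \<and>
     (\<forall>i<n. \<forall>j<n. (\<Sum>l<n. W i l * W j l) = (if i = j then real k else 0))"

text \<open>Symbolic entries of an orthogonal design: an integer e encodes
  0 if e = 0, x_e if e > 0 and -x_(-e) if e < 0 (variables x_1..x_u).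
  Evaluation at a real point x :: nat => real.\<close>
definition od_eval :: "(nat \<Rightarrow> real) \<Rightarrow> int \<Rightarrow> real" where
  "od_eval x e = of_int (sgn e) * x (nat \<bar>e\<bar>)"

definition od_form :: "nat \<Rightarrow> (nat \<Rightarrow> nat) \<Rightarrow> (nat \<Rightarrow> real) \<Rightarrow> real" where
  "od_form u s x = (\<Sum>t\<in>{1..u}. real (s t) * (x t)^2)"

text \<open>Orthogonal design of order n and type (s_1,...,s_u) in variables x_1..x_u.
  The polynomial identity D D^T = (sum s_i x_i^2) I is stated for all real values of
  the variables (equivalent, since R is infinite).\<close>
definition orthogonal_design :: "nat \<Rightarrow> nat \<Rightarrow> (nat \<Rightarrow> nat) \<Rightarrow> (nat \<Rightarrow> nat \<Rightarrow> int) \<Rightarrow> bool" where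
  "orthogonal_design n u s D \<longleftrightarrow>
     (\<forall>i<n. \<forall>j<n. nat \<bar>D i j\<bar> \<le> u) \<and>
     (\<forall>x. \<forall>i<n. \<forall>j<n.
        (\<Sum>l<n. od_eval x (D i l) * od_eval x (D j l)) = (if i = j then od_form u s x else 0))"

definition unbiased_od :: "nat \<Rightarrow> nat \<Rightarrow> (nat \<Rightarrow> nat) \<Rightarrow> real \<Rightarrow>
    (nat \<Rightarrow> nat \<Rightarrow> int) \<Rightarrow> (nat \<Rightarrow> nat \<Rightarrow> int) \<Rightarrow> bool" where
  "unbiased_od n u s \<alpha> D1 D2 \<longleftrightarrow>
     orthogonal_design n u s D1 \<and> orthogonal_design n u s D2 \<and> \<alpha> > 0 \<and>
     (\<exists>W :: nat \<Rightarrow> nat \<Rightarrow> real. (\<forall>i<n. \<forall>j<n. W i j \<in> {-1, 0, 1}) \<and>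
        (\<forall>x. \<forall>i<n. \<forall>j<n.
           (\<Sum>l<n. od_eval x (D1 i l) * od_eval x (D2 j l)) = od_form u s x / sqrt \<alpha> * W i j))"

definition quasi_unbiased :: "nat \<Rightarrow> nat \<Rightarrow> nat \<Rightarrow> real \<Rightarrow>
    (nat \<Rightarrow> nat \<Rightarrow> real) \<Rightarrow> (nat \<Rightarrow> nat \<Rightarrow> real) \<Rightarrow> bool" where
  "quasi_unbiased n k l a W1 W2 \<longleftrightarrow>
     weighing_matrix n k W1 \<and> weighing_matrix n k W2 \<and>
     weighing_matrix n l (\<lambda>i j. (\<Sum>t<n. W1 i t * W2 j t) / sqrt a)"

definition distinct_mat :: "nat \<Rightarrow> (nat \<Rightarrow> nat \<Rightarrow> 'a) \<Rightarrow> (nat \<Rightarrow> nat \<Rightarrow> 'a) \<Rightarrow> bool" where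
  "distinct_mat n A B \<longleftrightarrow> (\<exists>i<n. \<exists>j<n. A i j \<noteq> B i j)"

definition prime_power :: "nat \<Rightarrow> bool" where
  "prime_power q \<longleftrightarrow> (\<exists>p e. prime p \<and> e \<ge> 1 \<and> q = p ^ e)"

end

theory Submission
  imports Defs "HOL-Computational_Algebra.Polynomial" "HOL-Library.Indicator_Function"
    "Jordan_Normal_Form.Determinant"
begin

text \<open>
  Index the \<open>m * q\<close> columns by points \<open>(y, i)\<close> with \<open>y\<close> in the field of order \<open>q\<close> and \<open>i\<close> among
  \<open>m\<close> of its elements. A nonzero slope \<open>a\<close> partitions the points into \<open>q\<close> lines \<open>y = a * i + x\<close> of
  \<open>m\<close> points. Writing the rows of the weighing matrix on each line gives a weighing matrix \<open>A a\<close> of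
  order \<open>m * q\<close> and weight \<open>k\<close>. Lines of different slopes meet in at most one point, so
  \<open>V = A a * (A b)\<^sup>T\<close> has entries in \<open>{-1, 0, 1}\<close>. A line meets each group \<open>{y} \<times> {..<m}\<close> at most
  once, so \<open>A a * (I \<otimes> D)\<close> still has monomial entries when \<open>D\<close> is the given orthogonal design, and
  the product of two of these designs is \<open>(\<Sum>i. s\<^sub>i x\<^sub>i\<^sup>2) V\<close>. Weighing matrices arise by
  evaluating at the indicator vector of \<open>S\<close>.

  The field of order \<open>q = p ^ e\<close> is realised inside \<open>\<complex>\<close>: the roots of \<open>z ^ q = z\<close> represent the
  elements of a field of order \<open>q\<close> modulo a prime ideal, containing \<open>p\<close>, of the ring they generate.
\<close>

subsection \<open>Finite fields from roots of unity\<close>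

text \<open>The additive subgroup generated by \<open>T\<close>, built by one signed generator per
  step so that additive facts can be checked on generators. For \<open>T\<close> closed under
  multiplication and containing 1 it is the subring generated by \<open>T\<close>.\<close>

inductive_set int_span :: "'a::ring_1 set \<Rightarrow> 'a set" for T where
  zero: "0 \<in> int_span T"
| add: "x \<in> int_span T \<Longrightarrow> t \<in> T \<Longrightarrow> x + t \<in> int_span T"
| diff: "x \<in> int_span T \<Longrightarrow> t \<in> T \<Longrightarrow> x - t \<in> int_span T"

lemma int_span_base: "t \<in> T \<Longrightarrow> t \<in> int_span T"
  using int_span.add[OF int_span.zero] by simp

lemma int_span_add:
  assumes "x \<in> int_span T" "y \<in> int_span T"
  shows "x + y \<in> int_span T"
  using assms(2,1)
  by (induction) (auto simp: add.assoc[symmetric] add_diff_eq intro: int_span.intros)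

lemma int_span_minus: "x \<in> int_span T \<Longrightarrow> - x \<in> int_span T"
proof (induction rule: int_span.induct)
  case zero
  then show ?case by (simp add: int_span.zero)
next
  case (add x t)
  then show ?case using int_span.diff[of "- x" T t] by simp
next
  case (diff x t)
  then show ?case using int_span.add[of "- x" T t] by simp
qed

lemma int_span_mult:
  assumes closed: "\<And>s t. s \<in> T \<Longrightarrow> t \<in> T \<Longrightarrow> s * t \<in> T"
    and "x \<in> int_span T" "y \<in> int_span T"
  shows "x * y \<in> int_span T"
proof -
  have 1: "x * t \<in> int_span T" if "t \<in> T" for t
    using assms(2)
    by induction (auto simp: distrib_right left_diff_distrib that closed intro: int_span.intros)
  show ?thesis using assms(3)
  proof induction
    case zero
    then show ?case by (simp add: int_span.zero)
  next
    case (add y t)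
    then show ?case by (simp add: distrib_left int_span_add 1)
  next
    case (diff y t)
    have "x * y + - (x * t) \<in> int_span T"
      by (intro int_span_add int_span_minus 1 diff)
    then show ?case by (simp add: right_diff_distrib)
  qed
qed

text \<open>Extend \<open>{1}\<close> to a basis over the rationals and take the coordinate at 1.
  This turns questions about integer spans into questions about denominators.\<close>

lemma rational_functional:
  obtains \<phi> :: "'a::field_char_0 \<Rightarrow> rat"
  where "\<And>x y. \<phi> (x + y) = \<phi> x + \<phi> y" "\<And>r x. \<phi> (of_rat r * x) = r * \<phi> x" "\<phi> 1 = 1"
proof -
  interpret vector_space_pair "\<lambda>r (x::'a). of_rat r * x" "(*) :: rat \<Rightarrow> rat \<Rightarrow> rat"
    by unfold_locales (auto simp: algebra_simps of_rat_add of_rat_mult)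
  have ind: "vs1.independent {1}"
    by (subst vs1.independent_insert) (auto simp: vs1.dependent_def)
  show thesis
  proof (rule that)
    show "construct {1} (\<lambda>_. 1) (x + y) = construct {1} (\<lambda>_. 1) x + construct {1} (\<lambda>_. 1) y" for x y
      using linear_construct[OF ind] by (rule linear_add)
    show "construct {1} (\<lambda>_. 1) (of_rat r * x) = r * construct {1} (\<lambda>_. 1) x" for r x
      using linear_construct[OF ind] by (rule linear_scale)
    show "construct {1} (\<lambda>_. 1) 1 = 1"
      by (rule construct_basis[OF ind]) auto
  qed
qed

text \<open>The values of \<open>\<phi>\<close> on the span have a common denominator
  \<open>d\<close>. If \<open>1 / p\<close> were in the span, so would be its powers, and the value
  \<open>1 / p ^ j\<close> would force \<open>p ^ j dvd d\<close> for every
  \<open>j\<close>.\<close>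

lemma prime_not_unit_int_span:
  fixes T :: "'a::field_char_0 set"
  assumes fin: "finite T" and one: "1 \<in> T"
    and closed: "\<And>s t. s \<in> T \<Longrightarrow> t \<in> T \<Longrightarrow> s * t \<in> T"
    and p: "prime (p::nat)"
  shows "1 / of_nat p \<notin> int_span T"
proof
  assume inv: "1 / of_nat p \<in> int_span T"
  obtain \<phi> :: "'a \<Rightarrow> rat" where add: "\<And>x y. \<phi> (x + y) = \<phi> x + \<phi> y"
    and scale: "\<And>r x. \<phi> (of_rat r * x) = r * \<phi> x" and \<phi>1: "\<phi> 1 = 1"
    by (rule rational_functional) blast
  have minus: "\<phi> (- x) = - \<phi> x" for x using scale[of "-1" x] by simp
  have \<phi>diff: "\<phi> (x - y) = \<phi> x - \<phi> y" for x y using add[of x "- y"] minus[of y] by simp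
  have \<phi>0: "\<phi> 0 = 0" using scale[of 0 0] by simp
  \<comment> \<open>The product of the reduced denominators at the finitely many generators.\<close>
  define d :: nat where "d = (\<Prod>t\<in>T. nat (snd (quotient_of (\<phi> t))))"
  have dpos: "d > 0" unfolding d_def using fin by (auto simp: quotient_of_denom_pos')
  have dT: "of_nat d * \<phi> t \<in> \<int>" if t: "t \<in> T" for t
  proof -
    obtain a b where ab: "quotient_of (\<phi> t) = (a, b)" by fastforce
    have b: "b > 0" "\<phi> t = of_int a / of_int b"
      using ab by (auto simp: quotient_of_denom_pos quotient_of_div)
    have "nat b dvd d" unfolding d_def using fin t ab by (metis dvd_prodI snd_conv)
    then obtain c where "d = nat b * c" by (elim dvdE)
    then have "of_nat d * \<phi> t = of_int (int c * a)"
      using b by simp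
    then show ?thesis by simp
  qed
  have int: "of_nat d * \<phi> x \<in> \<int>" if "x \<in> int_span T" for x
    using that by induction (auto simp: \<phi>0 \<phi>diff add distrib_left right_diff_distrib dT)
  have "p ^ j dvd d" for j
  proof -
    have "(1 / of_nat p) ^ j \<in> int_span T"
    proof (induction j)
      case 0
      then show ?case by (simp add: int_span_base one)
    next
      case (Suc j)
      then show ?case unfolding power_Suc by (intro int_span_mult[OF closed] inv)
    qed
    moreover have "(1 / of_nat p :: 'a) ^ j = of_rat (1 / of_nat p ^ j) * 1"
      by (simp add: of_rat_divide of_rat_power power_one_over)
    ultimately have "of_nat d * \<phi> (of_rat (1 / of_nat p ^ j) * 1) \<in> \<int>"
      using int by metis
    then have "of_nat d / of_nat (p ^ j) \<in> (\<int> :: rat set)"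
      unfolding scale \<phi>1 by simp
    then obtain z :: int where "of_nat d / of_nat (p ^ j) = (of_int z :: rat)"
      by (elim Ints_cases)
    then have "(of_nat d :: rat) = of_int z * of_nat (p ^ j)"
      using p by (simp add: field_simps prime_gt_0_nat)
    then have "(of_int (int d) :: rat) = of_int (z * int (p ^ j))" by simp
    then have "int d = z * int (p ^ j)" by (simp only: of_int_eq_iff)
    then show ?thesis by (metis dvd_triv_right int_dvd_int_iff)
  qed
  \<comment> \<open>The exponent \<open>j = d\<close> is already too large, because
    \<open>d < 2 ^ d \<le> p ^ d\<close>.\<close>
  from dvd_imp_le[OF this dpos] have "p ^ d \<le> d" .
  moreover have "d < 2 ^ d" by (rule less_exp)
  moreover have "2 ^ d \<le> p ^ d" using p by (intro power_mono prime_ge_2_nat) auto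
  ultimately show False by linarith
qed

section \<open>Prime ideals of a subring\<close>

definition set_ideal :: "'a::comm_ring_1 set \<Rightarrow> 'a set \<Rightarrow> bool" where
  "set_ideal R I \<longleftrightarrow> I \<subseteq> R \<and> 0 \<in> I \<and> (\<forall>x\<in>I. \<forall>y\<in>I. x + y \<in> I) \<and> (\<forall>r\<in>R. \<forall>x\<in>I. r * x \<in> I)"

text \<open>Zorn's lemma yields an ideal that is maximal among those containing \<open>a\<close> and
  avoiding 1, and such an ideal is prime. The principal ideal of \<open>a\<close> is a first
  candidate, since \<open>a\<close> is not a unit of \<open>R\<close>.\<close>

lemma prime_ideal_exists:
  fixes R :: "'a::comm_ring_1 set"
  assumes R1: "1 \<in> R" and Radd: "\<And>x y. x \<in> R \<Longrightarrow> y \<in> R \<Longrightarrow> x + y \<in> R"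
    and Rminus: "\<And>x. x \<in> R \<Longrightarrow> - x \<in> R"
    and Rmult: "\<And>x y. x \<in> R \<Longrightarrow> y \<in> R \<Longrightarrow> x * y \<in> R"
    and a: "a \<in> R" "\<And>x. x \<in> R \<Longrightarrow> x * a \<noteq> 1"
  obtains P where "set_ideal R P" "a \<in> P" "1 \<notin> P"
    "\<And>x y. x \<in> R \<Longrightarrow> y \<in> R \<Longrightarrow> x * y \<in> P \<Longrightarrow> x \<in> P \<or> y \<in> P"
proof -
  define I where "I = {I. set_ideal R I \<and> a \<in> I \<and> 1 \<notin> I}"
  have R0: "0 \<in> R" using Radd[OF R1 Rminus[OF R1]] by simp
  have "(\<lambda>x. x * a) ` R \<in> I"
  proof -
    have "set_ideal R ((\<lambda>x. x * a) ` R)"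
      unfolding set_ideal_def
    proof (intro conjI ballI)
      show "(\<lambda>x. x * a) ` R \<subseteq> R" using Rmult a by auto
      show "0 \<in> (\<lambda>x. x * a) ` R" by (rule image_eqI[of _ _ 0]) (auto simp: R0)
      fix x y assume "x \<in> (\<lambda>x. x * a) ` R" "y \<in> (\<lambda>x. x * a) ` R"
      then obtain r s where "r \<in> R" "s \<in> R" "x = r * a" "y = s * a" by auto
      then show "x + y \<in> (\<lambda>x. x * a) ` R"
        by (intro image_eqI[of _ _ "r + s"]) (auto simp: Radd distrib_right)
    next
      fix r x assume "r \<in> R" "x \<in> (\<lambda>x. x * a) ` R"
      then obtain s where "r \<in> R" "s \<in> R" "x = s * a" by auto
      then show "r * x \<in> (\<lambda>x. x * a) ` R"
        by (intro image_eqI[of _ _ "r * s"]) (auto simp: Rmult mult.assoc)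
    qed
    moreover have "a \<in> (\<lambda>x. x * a) ` R" by (rule image_eqI[of _ _ 1]) (auto simp: R1)
    ultimately show ?thesis using a(2) by (force simp: I_def)
  qed
  then have "I \<noteq> {}" by auto
  \<comment> \<open>Two elements of the union lie in a common member of the chain, and 1 lies in no
    member.\<close>
  moreover have "\<Union>C \<in> I" if "C \<noteq> {}" and ch: "subset.chain I C" for C
  proof -
    have C: "set_ideal R J" "a \<in> J" "1 \<notin> J" if "J \<in> C" for J
      using that ch unfolding subset.chain_def I_def by auto
    have tot: "J \<subseteq> K \<or> K \<subseteq> J" if "J \<in> C" "K \<in> C" for J K
      using that ch unfolding subset.chain_def by auto
    have "x + y \<in> \<Union>C" if "x \<in> \<Union>C" "y \<in> \<Union>C" for x y
    proof -
      from that obtain J K where JK: "J \<in> C" "K \<in> C" "x \<in> J" "y \<in> K" by auto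
      from tot[OF JK(1,2)] show ?thesis
      proof
        assume "J \<subseteq> K"
        then have "x + y \<in> K" using JK C(1)[OF JK(2)] unfolding set_ideal_def by blast
        then show ?thesis using JK by auto
      next
        assume "K \<subseteq> J"
        then have "x + y \<in> J" using JK C(1)[OF JK(1)] unfolding set_ideal_def by blast
        then show ?thesis using JK by auto
      qed
    qed
    moreover have "\<Union>C \<subseteq> R" using C(1) unfolding set_ideal_def by blast
    moreover have "0 \<in> \<Union>C" using C(1) \<open>C \<noteq> {}\<close> unfolding set_ideal_def by blast
    moreover have "\<forall>r\<in>R. \<forall>x\<in>\<Union>C. r * x \<in> \<Union>C" using C(1) unfolding set_ideal_def by blast
    ultimately have "set_ideal R (\<Union>C)" unfolding set_ideal_def by blast
    then show ?thesis using C \<open>C \<noteq> {}\<close> by (auto simp: I_def)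
  qed
  ultimately obtain P where P: "P \<in> I" and max: "\<And>X. X \<in> I \<Longrightarrow> P \<subseteq> X \<Longrightarrow> X = P"
    using subset_Zorn_nonempty[of I] by blast
  have idP: "set_ideal R P" and aP: "a \<in> P" and 1: "1 \<notin> P" using P by (auto simp: I_def)
  have PR: "x \<in> P \<Longrightarrow> x \<in> R" for x using idP unfolding set_ideal_def by blast
  have Padd: "x \<in> P \<Longrightarrow> y \<in> P \<Longrightarrow> x + y \<in> P" for x y using idP unfolding set_ideal_def by blast
  have Pmult: "r \<in> R \<Longrightarrow> y \<in> P \<Longrightarrow> r * y \<in> P" for r y using idP unfolding set_ideal_def by blast
  have P0: "0 \<in> P" using idP unfolding set_ideal_def by blast
  \<comment> \<open>Otherwise the ideal generated by \<open>P\<close> and \<open>x\<close> would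
    contradict maximality.\<close>
  have gen: "\<exists>u\<in>P. \<exists>r\<in>R. 1 = u + r * x" if x: "x \<in> R" "x \<notin> P" for x
  proof (rule ccontr)
    assume no: "\<not> ?thesis"
    define J where "J = {u + r * x | u r. u \<in> P \<and> r \<in> R}"
    have inJ: "u + r * x \<in> J" if "u \<in> P" "r \<in> R" for u r using that by (auto simp: J_def)
    have PJ: "P \<subseteq> J" using inJ[OF _ R0] by auto
    have "set_ideal R J"
      unfolding set_ideal_def
    proof (intro conjI ballI)
      show "J \<subseteq> R" using PR Rmult Radd x by (auto simp: J_def)
      show "0 \<in> J" using PJ P0 by auto
      fix y z assume "y \<in> J" "z \<in> J"
      then obtain u r v s where *: "u \<in> P" "r \<in> R" "v \<in> P" "s \<in> R" "y = u + r * x" "z = v + s * x"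
        by (auto simp: J_def)
      have "y + z = (u + v) + (r + s) * x" by (simp add: * algebra_simps)
      then show "y + z \<in> J" using inJ[OF Padd[OF *(1,3)] Radd[OF *(2,4)]] by simp
    next
      fix s y assume s: "s \<in> R" and "y \<in> J"
      then obtain u r where *: "u \<in> P" "r \<in> R" "y = u + r * x"
        by (auto simp: J_def)
      have "s * y = s * u + (s * r) * x" by (simp add: * algebra_simps)
      then show "s * y \<in> J" using inJ[OF Pmult[OF s *(1)] Rmult[OF s *(2)]] by simp
    qed
    moreover have "1 \<notin> J" using no by (auto simp: J_def)
    ultimately have "J \<in> I" using PJ aP by (auto simp: I_def)
    with max PJ have "J = P" by auto
    moreover have "x \<in> J" using inJ[OF P0 R1] by simp
    ultimately show False using x by simp
  qed
  have "x \<in> P \<or> y \<in> P" if x: "x \<in> R" and y: "y \<in> R" and xy: "x * y \<in> P" for x y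
  proof (rule ccontr)
    assume "\<not> ?thesis"
    then obtain u r where *: "u \<in> P" "r \<in> R" "1 = u + r * x" and "y \<notin> P" using gen[OF x] by auto
    \<comment> \<open>Multiplying \<open>1 = u + r * x\<close> by \<open>y\<close> exhibits
      \<open>y\<close> as an element of \<open>P\<close>.\<close>
    have "y = y * u + r * (x * y)" using *(3) by (metis distrib_left mult.assoc mult.commute mult.right_neutral)
    moreover have "y * u + r * (x * y) \<in> P" by (intro Padd Pmult * xy y)
    ultimately show False using \<open>y \<notin> P\<close> by simp
  qed
  with that idP aP 1 show ?thesis by blast
qed

section \<open>The roots of \<open>z ^ q = z\<close> and their arithmetic modulo a prime
  ideal\<close>

lemma power_eq_self_iff:
  fixes z :: "'a::idom"
  assumes "q > 0"
  shows "z ^ q = z \<longleftrightarrow> z = 0 \<or> z ^ (q - 1) = 1"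
proof -
  have "z ^ q = z * z ^ (q - 1)" using assms by (simp add: power_eq_if)
  then show ?thesis by (metis mult_cancel_left mult.right_neutral)
qed

text \<open>The solutions are 0 and the \<open>q - 1\<close> complex roots of
  \<open>z ^ (q - 1) = 1\<close>.\<close>

lemma card_power_fixed:
  assumes "q \<ge> 2"
  shows "finite {z::complex. z ^ q = z}" "card {z::complex. z ^ q = z} = q"
proof -
  have eq: "{z::complex. z ^ q = z} = insert 0 {z. z ^ (q - 1) = 1}"
    using assms by (auto simp: power_eq_self_iff)
  have fin: "finite {z::complex. z ^ (q - 1) = 1}" using assms by (intro finite_roots_unity) auto
  then show "finite {z::complex. z ^ q = z}" by (simp add: eq)
  show "card {z::complex. z ^ q = z} = q"
    unfolding eq using assms fin card_roots_unity_eq[of "q - 1"] by (simp add: power_0_left)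
qed

text \<open>Both sides come from monic polynomials of degree \<open>q\<close> that vanish at the
  same \<open>q\<close> points, so their difference has smaller degree and is 0.\<close>

lemma prod_power_fixed:
  fixes x :: complex
  assumes q: "q \<ge> 2"
  shows "(\<Prod>t\<in>{z. z ^ q = z}. x - t) = x ^ q - x"
proof -
  define T where "T = {z::complex. z ^ q = z}"
  define f where "f = (\<Prod>t\<in>T. [:-t, 1:])"
  define g where "g = monom (1::complex) q - [:0, 1:]"
  have T: "finite T" "card T = q" unfolding T_def using card_power_fixed[OF q] .
  have df: "degree f = q" unfolding f_def using T
    by (subst degree_prod_eq_sum_degree) (auto simp: T)
  have lf: "lead_coeff f = 1" unfolding f_def by (simp add: lead_coeff_prod)
  have d1: "degree [:0, 1::complex:] < degree (monom (1::complex) q)"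
    using q by (simp add: degree_monom_eq)
  have dg: "degree g = q" 
    unfolding g_def diff_conv_add_uminus using d1
    by (subst degree_add_eq_left) (auto simp: degree_monom_eq)
  have lg: "lead_coeff g = 1"
    unfolding dg using q by (simp add: g_def coeff_eq_0)
  have "f = g"
  proof (rule poly_eqI_degree_lead_coeff[where n = q and A = T])
    show "poly f z = poly g z" if "z \<in> T" for z
    proof -
      have "poly f z = 0" unfolding f_def poly_prod using that T by (auto intro!: prod_zero)
      then show ?thesis using that by (simp add: g_def T_def poly_monom)
    qed
  qed (use df dg lf lg T in auto)
  then have "poly f x = poly g x" by simp
  then show ?thesis by (simp add: f_def g_def T_def poly_prod poly_monom)
qed

text \<open>The inner binomial coefficients are divisible by \<open>p\<close>. Keeping the cofactor
  \<open>r\<close> in \<open>R\<close> places the error term in every ideal of \<open>R\<close> that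
  contains \<open>p\<close>.\<close>

lemma binomial_prime_power:
  fixes x y :: "'a::comm_ring_1"
  assumes p: "prime p" and R1: "1 \<in> R"
    and Radd: "\<And>x y. x \<in> R \<Longrightarrow> y \<in> R \<Longrightarrow> x + y \<in> R"
    and Rmult: "\<And>x y. x \<in> R \<Longrightarrow> y \<in> R \<Longrightarrow> x * y \<in> R"
    and R0: "0 \<in> R" and xy: "x \<in> R" "y \<in> R"
  shows "\<exists>r\<in>R. (x + y) ^ p = x ^ p + y ^ p + of_nat p * r"
proof -
  have nat: "of_nat n \<in> R" for n by (induction n) (auto simp: R0 R1 Radd)
  have pow: "z ^ n \<in> R" if "z \<in> R" for z n by (induction n) (auto simp: R1 Rmult that)
  have sum: "sum f A \<in> R" if "\<And>i. i \<in> A \<Longrightarrow> f i \<in> R" for f and A :: "nat set"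
    using that by (induction A rule: infinite_finite_induct) (auto simp: R0 Radd)
  have p1: "p > 1" using p by (rule prime_gt_1_nat)
  define r where "r = (\<Sum>k=1..<p. of_nat ((p choose k) div p) * x ^ k * y ^ (p - k))"
  have "of_nat p * r = (\<Sum>k=1..<p. of_nat (p choose k) * x ^ k * y ^ (p - k))"
    unfolding r_def sum_distrib_left
  proof (rule sum.cong[OF refl])
    fix k assume "k \<in> {1..<p}"
    then have "p dvd p choose k" using p by (intro dvd_choose_prime) auto
    then have "p choose k = p * ((p choose k) div p)" by simp
    then show "of_nat p * (of_nat ((p choose k) div p) * x ^ k * y ^ (p - k))
      = of_nat (p choose k) * x ^ k * y ^ (p - k)"
      by (metis mult.assoc of_nat_mult)
  qed
  moreover have "(x + y) ^ p = (\<Sum>k\<le>p. of_nat (p choose k) * x ^ k * y ^ (p - k))"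
    by (rule binomial_ring)
  moreover have "{..p} = insert 0 (insert p {1..<p})" using p1 by auto
  ultimately have "(x + y) ^ p = x ^ p + y ^ p + of_nat p * r"
    using p1 by (simp add: algebra_simps)
  moreover have "r \<in> R" unfolding r_def by (intro sum Rmult nat pow xy)
  ultimately show ?thesis by blast
qed

text \<open>Multiplication is exact in \<open>T\<close>, addition holds modulo the prime ideal
  \<open>P\<close>. Distinct representatives stay distinct because \<open>z ^ (q - 1) - 1\<close>
  has only simple roots in characteristic \<open>p\<close>; sums have representatives because the
  Frobenius map is additive there. The last property says that the quotient by \<open>P\<close> has
  no zero divisors.\<close>

lemma field_representatives:
  assumes "prime_power q"
  obtains T and P :: "complex set"
  where "finite T" "card T = q" "0 \<in> T" "\<And>s t. s \<in> T \<Longrightarrow> t \<in> T \<Longrightarrow> s * t \<in> T"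
    "0 \<in> P" "\<And>x y. x \<in> P \<Longrightarrow> y \<in> P \<Longrightarrow> x + y \<in> P" "\<And>x. x \<in> P \<Longrightarrow> - x \<in> P"
    "\<And>s t. s \<in> T \<Longrightarrow> t \<in> T \<Longrightarrow> s - t \<in> P \<Longrightarrow> s = t"
    "\<And>s t. s \<in> T \<Longrightarrow> t \<in> T \<Longrightarrow> \<exists>w\<in>T. s + t - w \<in> P"
    "\<And>r s t u. r \<in> T \<Longrightarrow> s \<in> T \<Longrightarrow> t \<in> T \<Longrightarrow> u \<in> T \<Longrightarrow> (r - s) * (t - u) \<in> P \<Longrightarrow> r = s \<or> t = u"
proof -
  obtain p e where p: "prime p" and e: "e \<ge> 1" and qpe: "q = p ^ e"
    using assms by (auto simp: prime_power_def)
  have q: "q \<ge> 2" unfolding qpe using e self_le_power[of p e] prime_ge_2_nat[OF p] by linarith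
  define T where "T = {z::complex. z ^ q = z}"
  define R where "R = int_span T"
  have T: "finite T" "card T = q" unfolding T_def using card_power_fixed[OF q] .
  have T01: "0 \<in> T" "1 \<in> T" using q by (auto simp: T_def)
  have Tmult: "s * t \<in> T" if "s \<in> T" "t \<in> T" for s t using that by (simp add: T_def power_mult_distrib)
  have R1: "1 \<in> R" and R0: "0 \<in> R" and RT: "\<And>t. t \<in> T \<Longrightarrow> t \<in> R"
    and Radd: "\<And>x y. x \<in> R \<Longrightarrow> y \<in> R \<Longrightarrow> x + y \<in> R"
    and Rminus: "\<And>x. x \<in> R \<Longrightarrow> - x \<in> R"
    and Rmult: "\<And>x y. x \<in> R \<Longrightarrow> y \<in> R \<Longrightarrow> x * y \<in> R"
    using T01 Tmult unfolding R_def
    by (auto intro: int_span_base int_span_add int_span_minus int_span_mult)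
  have Rdiff: "x - y \<in> R" if "x \<in> R" "y \<in> R" for x y using Radd[OF that(1) Rminus[OF that(2)]] by simp
  have Rnat: "of_nat n \<in> R" for n by (induction n) (auto simp: R0 R1 Radd)
  have Rpow: "z ^ n \<in> R" if "z \<in> R" for z n by (induction n) (auto simp: R1 Rmult that)
  have "x * of_nat p \<noteq> 1" if "x \<in> R" for x
  proof
    assume "x * of_nat p = 1"
    moreover have "of_nat p \<noteq> (0::complex)" using prime_gt_0_nat[OF p] by simp
    ultimately have "x = 1 / of_nat p" by (metis nonzero_eq_divide_eq)
    then show False using prime_not_unit_int_span[OF T(1) T01(2) Tmult p] that by (simp add: R_def)
  qed
  then obtain P where P: "set_ideal R P" "of_nat p \<in> P" "1 \<notin> P"
    "\<And>x y. x \<in> R \<Longrightarrow> y \<in> R \<Longrightarrow> x * y \<in> P \<Longrightarrow> x \<in> P \<or> y \<in> P"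
    using prime_ideal_exists[of R "of_nat p", OF R1 Radd Rminus Rmult Rnat] by blast
  have Padd: "x \<in> P \<Longrightarrow> y \<in> P \<Longrightarrow> x + y \<in> P" for x y using P(1) unfolding set_ideal_def by blast
  have Pmult: "r \<in> R \<Longrightarrow> y \<in> P \<Longrightarrow> r * y \<in> P" for r y using P(1) unfolding set_ideal_def by blast
  have P0: "0 \<in> P" using P(1) unfolding set_ideal_def by blast
  have Pminus: "- x \<in> P" if "x \<in> P" for x using Pmult[OF Rminus[OF R1] that] by simp
  have Pdiff: "x - y \<in> P" if "x \<in> P" "y \<in> P" for x y using Padd[OF that(1) Pminus[OF that(2)]] by simp
  have Pprod: "\<exists>t\<in>A. f t \<in> P" if "finite A" "\<And>t. t \<in> A \<Longrightarrow> f t \<in> R" "prod f A \<in> P" for f and A :: "complex set"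
  proof -
    have "prod f A \<in> R \<and> (prod f A \<in> P \<longrightarrow> (\<exists>t\<in>A. f t \<in> P))"
      using that(1,2) by (induction A) (auto simp: R1 P(3) Rmult dest: P(4))
    then show ?thesis using that by blast
  qed
  have Ppow: "x ^ n - y ^ n \<in> P" if x: "x \<in> R" and y: "y \<in> R" and xy: "x - y \<in> P" for x y n
  proof (induction n)
    case 0
    then show ?case by (simp add: P0)
  next
    case (Suc n)
    have "x ^ Suc n - y ^ Suc n = x * (x ^ n - y ^ n) + y ^ n * (x - y)" by (simp add: algebra_simps)
    also have "\<dots> \<in> P" using Suc by (intro Padd Pmult x xy Rpow y)
    finally show ?case .
  qed
  \<comment> \<open>Induction on \<open>j\<close>: \<open>Ppow\<close> raises the congruence to the
    power \<open>p\<close>, and the binomial error is a multiple of \<open>p\<close>.\<close>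
  have frob: "(x + y) ^ (p ^ j) - (x ^ (p ^ j) + y ^ (p ^ j)) \<in> P" if xy: "x \<in> R" "y \<in> R" for x y j
  proof (induction j)
    case 0
    then show ?case by (simp add: P0)
  next
    case (Suc j)
    let ?X = "x ^ (p ^ j)" and ?Y = "y ^ (p ^ j)"
    obtain r where r: "r \<in> R" "(?X + ?Y) ^ p = ?X ^ p + ?Y ^ p + of_nat p * r"
      using binomial_prime_power[OF p R1 Radd Rmult R0 Rpow[OF xy(1)] Rpow[OF xy(2)]] by blast
    have "((x + y) ^ (p ^ j)) ^ p - (?X + ?Y) ^ p \<in> P"
      using Suc by (intro Ppow Rpow Radd xy)
    moreover have "r * of_nat p \<in> P" by (intro Pmult r P)
    ultimately have "((x + y) ^ (p ^ j)) ^ p - (?X + ?Y) ^ p + r * of_nat p \<in> P" by (rule Padd)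
    then show ?case unfolding r by (simp add: power_mult[symmetric] mult.commute algebra_simps)
  qed
  have qP: "of_nat q \<in> P"
  proof -
    have "of_nat p ^ (e - 1) * of_nat p \<in> P" by (intro Pmult Rpow Rnat P)
    moreover have "q = p ^ (e - 1) * p" using e by (simp add: qpe power_eq_if)
    ultimately show ?thesis by simp
  qed
  have sep: "s = t" if s: "s \<in> T" and t: "t \<in> T" and st: "s - t \<in> P" for s t
  proof (rule ccontr)
    assume ne: "s \<noteq> t"
    have inv: "z ^ (q - 1) = 1" if "z \<in> T" "z \<noteq> 0" for z
      using that q power_eq_self_iff[of q z] by (auto simp: T_def)
    \<comment> \<open>Nonzero elements of \<open>T\<close> are roots of unity, hence units of
      \<open>R\<close>. This excludes \<open>s = 0\<close> and \<open>t = 0\<close> below.\<close>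
    have nz: "z \<notin> P" if "z \<in> T" "z \<noteq> 0" for z
    proof
      assume z: "z \<in> P"
      have "q - 1 = Suc (q - 2)" using q by simp
      then have "z ^ (q - 1) = z ^ (q - 2) * z" by (simp only: power_Suc2)
      then have "1 = z ^ (q - 2) * z" using inv that by simp
      moreover have "z ^ (q - 2) * z \<in> P" using z that by (intro Pmult Rpow RT)
      ultimately show False using P(3) by simp
    qed
    have s0: "s \<noteq> 0"
    proof
      assume "s = 0"
      then have "t \<in> P" using Pminus[OF st] by simp
      then show False using nz t ne \<open>s = 0\<close> by auto
    qed
    have t0: "t \<noteq> 0" using nz[OF s s0] st by auto
    \<comment> \<open>The quotient of \<open>s ^ (q - 1) - t ^ (q - 1) = 0\<close> by
      \<open>s - t\<close> is exactly 0, but modulo \<open>P\<close> it is the derivative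
      \<open>(q - 1) * t ^ (q - 2)\<close>. Hence \<open>q - 1\<close> lies in \<open>P\<close>, and
      with \<open>q\<close> also 1.\<close>
    have "(s - t) * (\<Sum>i<q-1. t ^ (q - 1 - Suc i) * s ^ i) = s ^ (q - 1) - t ^ (q - 1)"
      by (rule power_diff_sumr2[symmetric])
    also have "\<dots> = 0" using inv s0 t0 s t by simp
    finally have z: "(\<Sum>i<q-1. t ^ (q - 1 - Suc i) * s ^ i) = 0" using ne by simp
    \<comment> \<open>Modulo \<open>P\<close> each \<open>s ^ i\<close> may be replaced by
      \<open>t ^ i\<close>.\<close>
    have c: "(\<Sum>i<n. t ^ (n - Suc i) * s ^ i) - of_nat n * t ^ (n - 1) \<in> P" for n
    proof -
      have "(\<Sum>i<n. t ^ (n - Suc i) * s ^ i) - of_nat n * t ^ (n - 1)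
          = (\<Sum>i<n. t ^ (n - Suc i) * (s ^ i - t ^ i))"
      proof -
        have "(\<Sum>i<n. t ^ (n - Suc i) * t ^ i) = (\<Sum>i<n. t ^ (n - 1))"
          by (intro sum.cong) (auto simp: power_add[symmetric])
        then show ?thesis by (simp add: right_diff_distrib sum_subtractf)
      qed
      also have "\<dots> \<in> P"
      proof -
        have Psum: "sum f A \<in> P" if "\<And>i. i \<in> A \<Longrightarrow> f i \<in> P" for f and A :: "nat set"
          using that by (induction A rule: infinite_finite_induct) (auto simp: P0 Padd)
        show ?thesis by (intro Psum Pmult Rpow RT Ppow s t st)
      qed
      finally show ?thesis .
    qed
    have "of_nat (q - 1) * t ^ (q - 1 - 1) \<in> P" using Pminus[OF c[of "q - 1"]] z by simp
    from Pmult[OF RT[OF t] this] have "of_nat (q - 1) * (t * t ^ (q - 1 - 1)) \<in> P"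
      by (simp only: mult.left_commute)
    moreover have "t * t ^ (q - 1 - 1) = t ^ (q - 1)"
      using q by (metis One_nat_def Suc_1 Suc_le_eq power_minus_mult mult.commute zero_less_diff)
    ultimately have "of_nat (q - 1) * t ^ (q - 1) \<in> P" by simp
    then have "of_nat (q - 1) \<in> P" using inv[OF t t0] by simp
    from Pdiff[OF qP this] have "1 \<in> P" using q by (simp add: of_nat_diff)
    with P(3) show False ..
  qed
  have sumT: "\<exists>w\<in>T. s + t - w \<in> P" if "s \<in> T" "t \<in> T" for s t
  proof -
    \<comment> \<open>By Frobenius, \<open>s + t\<close> is a root of \<open>z ^ q - z\<close>
      modulo \<open>P\<close>; primality then puts one of the linear factors in
      \<open>P\<close>.\<close>
    have "(s + t) ^ q - (s + t) \<in> P"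
      using frob[OF RT[OF that(1)] RT[OF that(2)], of e] that by (simp add: T_def qpe)
    then have "(\<Prod>w\<in>T. s + t - w) \<in> P" unfolding T_def prod_power_fixed[OF q] .
    then show ?thesis using T by (intro Pprod Rdiff Radd RT that) auto
  qed
  show thesis
  proof (rule that[of T P])
    show "r = s \<or> t = u" if "r \<in> T" "s \<in> T" "t \<in> T" "u \<in> T" "(r - s) * (t - u) \<in> P" for r s t u
      using P(4)[OF _ _ that(5)] that sep Rdiff RT by blast
  qed (use T T01 Tmult P0 Padd Pminus sep sumT in auto)
qed

section \<open>Lines over the field of order \<open>q\<close>\<close>

text \<open>\<open>h a i x\<close> is the height at abscissa \<open>i\<close> of the line with slope
  \<open>a\<close> and intercept \<open>x\<close>, all field elements being numbered below
  \<open>q\<close>. Each claim follows by subtracting incidence congruences; in the last two a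
  product of differences lands in \<open>P\<close>.\<close>

lemma finite_field_lines:
  assumes "prime_power q"
  obtains h :: "nat \<Rightarrow> nat \<Rightarrow> nat \<Rightarrow> nat"
  where "\<And>a i. a < q \<Longrightarrow> i < q \<Longrightarrow> bij_betw (h a i) {..<q} {..<q}"
    "\<And>a i j x. 0 < a \<Longrightarrow> a < q \<Longrightarrow> i < q \<Longrightarrow> j < q \<Longrightarrow> x < q \<Longrightarrow> h a i x = h a j x \<Longrightarrow> i = j"
    "\<And>a b i j x y. a < q \<Longrightarrow> b < q \<Longrightarrow> i < q \<Longrightarrow> j < q \<Longrightarrow> x < q \<Longrightarrow> y < q \<Longrightarrow> a \<noteq> b \<Longrightarrow>
      h a i x = h b i y \<Longrightarrow> h a j x = h b j y \<Longrightarrow> i = j"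
proof -
  obtain T and P :: "complex set"
  where T: "finite T" "card T = q" "0 \<in> T" and mult: "\<And>s t. s \<in> T \<Longrightarrow> t \<in> T \<Longrightarrow> s * t \<in> T"
    and P: "0 \<in> P" "\<And>x y. x \<in> P \<Longrightarrow> y \<in> P \<Longrightarrow> x + y \<in> P" "\<And>x. x \<in> P \<Longrightarrow> - x \<in> P"
    and sep: "\<And>s t. s \<in> T \<Longrightarrow> t \<in> T \<Longrightarrow> s - t \<in> P \<Longrightarrow> s = t"
    and add: "\<And>s t. s \<in> T \<Longrightarrow> t \<in> T \<Longrightarrow> \<exists>w\<in>T. s + t - w \<in> P"
    and dom: "\<And>r s t u. r \<in> T \<Longrightarrow> s \<in> T \<Longrightarrow> t \<in> T \<Longrightarrow> u \<in> T \<Longrightarrow> (r - s) * (t - u) \<in> P \<Longrightarrow> r = s \<or> t = u"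
    by (rule field_representatives[OF assms]) (rule that; assumption)
  have Pdiff: "x - y \<in> P" if "x \<in> P" "y \<in> P" for x y using P(2)[OF that(1) P(3)[OF that(2)]] by simp
  have "card (T - {0}) = q - 1" using T by simp
  then obtain g where g: "bij_betw g {..<q - 1} (T - {0})"
    using T(1) ex_bij_betw_nat_finite atLeast0LessThan by (metis finite_Diff)
  \<comment> \<open>Number 0 is reserved for the zero of the field, so that \<open>0 < a\<close>
    means a nonzero slope.\<close>
  define f where "f i = (if i = 0 then 0 else g (i - 1))" for i
  have q: "0 < q" using T by (metis card_gt_0_iff empty_iff)
  have gT: "g i \<in> T" "g i \<noteq> 0" if "i < q - 1" for i using g that by (auto simp: bij_betw_def)
  have ginj: "i = j" if "i < q - 1" "j < q - 1" "g i = g j" for i j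
    using g that by (auto simp: bij_betw_def dest: inj_onD)
  have gsurj: "\<exists>i<q - 1. g i = t" if "t \<in> T" "t \<noteq> 0" for t
  proof -
    have "t \<in> g ` {..<q - 1}" using g that by (simp add: bij_betw_def)
    then show ?thesis by auto
  qed
  have fT: "f i \<in> T" if "i < q" for i using gT(1)[of "i - 1"] that T(3) by (auto simp: f_def)
  have finj: "i = j" if "i < q" "j < q" "f i = f j" for i j
  proof (cases "i = 0 \<or> j = 0")
    case True
    then show ?thesis using gT(2)[of "i - 1"] gT(2)[of "j - 1"] that
      by (cases "i = 0"; cases "j = 0") (simp_all add: f_def)
  next
    case False
    then have ij: "0 < i" "0 < j" by auto
    then have "i - 1 = j - 1" using that by (intro ginj) (auto simp: f_def)
    then show ?thesis using ij by simp
  qed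
  have fsurj: "\<exists>i<q. f i = t" if "t \<in> T" for t
  proof (cases "t = 0")
    case True
    then show ?thesis using q by (auto simp: f_def)
  next
    case False
    then obtain i where "i < q - 1" "g i = t" using gsurj \<open>t \<in> T\<close> by blast
    then show ?thesis by (intro exI[of _ "Suc i"]) (auto simp: f_def)
  qed
  define h where "h a i x = (SOME y. y < q \<and> f a * f i + f x - f y \<in> P)" for a i x
  have h: "h a i x < q" "f a * f i + f x - f (h a i x) \<in> P" if "a < q" "i < q" "x < q" for a i x
  proof -
    have "\<exists>y. y < q \<and> f a * f i + f x - f y \<in> P"
      using add[OF mult[OF fT fT] fT, OF that] fsurj by metis
    from someI_ex[OF this] show "h a i x < q" "f a * f i + f x - f (h a i x) \<in> P"
      by (auto simp: h_def)
  qed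
  show thesis
  proof (rule that[of h])
    fix a i assume ai: "a < q" "i < q"
    have "inj_on (h a i) {..<q}"
    proof (rule inj_onI)
      fix x y assume xy: "x \<in> {..<q}" "y \<in> {..<q}" "h a i x = h a i y"
      with Pdiff[OF h(2)[of a i x] h(2)[of a i y]] ai have "f x - f y \<in> P" by simp
      then show "x = y" using sep finj fT xy by blast
    qed
    moreover have "h a i ` {..<q} \<subseteq> {..<q}" using h(1) ai by auto
    ultimately show "bij_betw (h a i) {..<q} {..<q}"
      by (simp add: bij_betw_def endo_inj_surj)
  next
    fix a i j x assume *: "0 < a" "a < q" "i < q" "j < q" "x < q" "h a i x = h a j x"
    \<comment> \<open>The intercepts cancel; \<open>f 0 = 0\<close> is inserted to obtain a product
      of differences.\<close>
    with Pdiff[OF h(2)[of a i x] h(2)[of a j x]]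
    have "(f a - f 0) * (f i - f j) \<in> P" by (simp add: f_def algebra_simps)
    then show "i = j" using dom[of "f a" "f 0" "f i" "f j"] finj fT * q by (metis less_not_refl)
  next
    fix a b i j x y
    assume *: "a < q" "b < q" "i < q" "j < q" "x < q" "y < q" "a \<noteq> b"
      "h a i x = h b i y" "h a j x = h b j y"
    \<comment> \<open>In the combination of the four incidences the intercepts and the heights
      cancel, which leaves \<open>(f a - f b) * (f i - f j)\<close>.\<close>
    have "(f a * f i + f x - f (h a i x)) - (f b * f i + f y - f (h b i y)) \<in> P"
      by (intro Pdiff h *)
    moreover have "(f a * f j + f x - f (h a j x)) - (f b * f j + f y - f (h b j y)) \<in> P"
      by (intro Pdiff h *)
    ultimately have "((f a * f i + f x - f (h a i x)) - (f b * f i + f y - f (h b i y)))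
      - ((f a * f j + f x - f (h a j x)) - (f b * f j + f y - f (h b j y))) \<in> P"
      by (rule Pdiff)
    moreover have "((f a * f i + f x - f (h a i x)) - (f b * f i + f y - f (h b i y)))
      - ((f a * f j + f x - f (h a j x)) - (f b * f j + f y - f (h b j y)))
      = (f a - f b) * (f i - f j)"
      using *(8,9) by (simp add: algebra_simps)
    ultimately have "(f a - f b) * (f i - f j) \<in> P" by simp
    then show "i = j" using dom[of "f a" "f b" "f i" "f j"] finj fT * by metis
  qed
qed

subsection \<open>Orthogonal designs on line classes\<close>

text \<open>The transpose divided by \<open>k\<close> is a right inverse of a square matrix, hence
  also a left inverse. Rational entries allow the division.\<close>

lemma gram_transpose:
  fixes M :: "nat \<Rightarrow> nat \<Rightarrow> int"
  assumes "\<And>i j. i < n \<Longrightarrow> j < n \<Longrightarrow> (\<Sum>l<n. M i l * M j l) = (if i = j then k else 0)"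
    and k: "k \<noteq> 0" and ij: "i < n" "j < n"
  shows "(\<Sum>l<n. M l i * M l j) = (if i = j then k else 0)"
proof -
  define A where "A = mat n n (\<lambda>(i, j). of_int (M i j) :: rat)"
  define B where "B = mat n n (\<lambda>(i, j). of_int (M j i) / of_int k :: rat)"
  have AB: "A * B = 1\<^sub>m n"
  proof (rule eq_matI)
    fix i j assume ij: "i < dim_row (1\<^sub>m n)" "j < dim_col (1\<^sub>m n)"
    then have "(A * B) $$ (i, j) = (\<Sum>l<n. of_int (M i l) * (of_int (M j l) / of_int k))"
      by (simp add: A_def B_def scalar_prod_def atLeast0LessThan)
    also have "\<dots> = of_int (\<Sum>l<n. M i l * M j l) / of_int k"
      by (simp add: sum_divide_distrib)
    also have "\<dots> = 1\<^sub>m n $$ (i, j)" using ij assms(1) k by simp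
    finally show "(A * B) $$ (i, j) = 1\<^sub>m n $$ (i, j)" .
  qed (simp_all add: A_def B_def)
  have "B * A = 1\<^sub>m n"
    by (rule mat_mult_left_right_inverse[OF _ _ AB]) (simp_all add: A_def B_def)
  then have "(B * A) $$ (i, j) = 1\<^sub>m n $$ (i, j)" by simp
  moreover have "(B * A) $$ (i, j) = (\<Sum>l<n. of_int (M l i) / of_int k * of_int (M l j))"
    using ij by (simp add: A_def B_def scalar_prod_def atLeast0LessThan)
  moreover have "\<dots> = of_int (\<Sum>l<n. M l i * M l j) / of_int k"
    by (simp add: sum_divide_distrib)
  ultimately have "(of_int (\<Sum>l<n. M l i * M l j) :: rat) = of_int k * 1\<^sub>m n $$ (i, j)"
    using k by (metis nonzero_divide_eq_eq of_int_eq_0_iff mult.commute)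
  also have "\<dots> = of_int (if i = j then k else 0)" using ij by simp
  finally show ?thesis by (simp only: of_int_eq_iff)
qed

section \<open>Block indices and evaluation of symbolic entries\<close>

lemma block_index_less:
  fixes y i m q :: nat
  assumes "y < q" "i < m"
  shows "y * m + i < m * q"
proof -
  have "y * m + i < (y + 1) * m" using assms by simp
  also have "\<dots> \<le> q * m" using assms by (intro mult_right_mono) auto
  finally show ?thesis by (simp add: mult.commute)
qed

lemma sum_blocks:
  fixes f :: "nat \<Rightarrow> 'a::comm_monoid_add"
  shows "(\<Sum>t<m * q. f t) = (\<Sum>y<q. \<Sum>i<m. f (y * m + i))"
proof (cases "m = 0")
  case False
  have "(\<Sum>y<q. \<Sum>i<m. f (y * m + i)) = (\<Sum>(y, i)\<in>{..<q} \<times> {..<m}. f (y * m + i))"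
    by (rule sum.cartesian_product)
  also have "\<dots> = (\<Sum>t<m * q. f t)"
  proof (rule sum.reindex_bij_witness[where i = "\<lambda>t. (t div m, t mod m)" and j = "\<lambda>(y, i). y * m + i"])
    show "(\<lambda>(y, i). y * m + i) yi \<in> {..<m * q}" if "yi \<in> {..<q} \<times> {..<m}" for yi
      using that block_index_less by auto
  qed (use False in \<open>auto simp: less_mult_imp_div_less mult.commute\<close>)
  finally show ?thesis by simp
qed simp

lemma od_eval_0 [simp]: "od_eval x 0 = 0"
  by (simp add: od_eval_def)

text \<open>A sign flips or deletes the encoded variable; a larger factor would change its
  index.\<close>

lemma od_eval_sign_mult: "w \<in> {-1, 0, 1} \<Longrightarrow> od_eval x (w * e) = of_int w * od_eval x e"
  by (auto simp: od_eval_def)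

lemma od_form_scale: "od_form u (\<lambda>i. k * s i) x = real k * od_form u s x"
  by (simp add: od_form_def sum_distrib_left mult.assoc)

lemma od_form_indicator:
  assumes "S \<subseteq> {1..u}"
  shows "od_form u s (indicator S) = real (\<Sum>i\<in>S. s i)"
proof -
  have "od_form u s (indicator S) = (\<Sum>t\<in>{1..u}. if t \<in> S then real (s t) else 0)"
    unfolding od_form_def by (intro sum.cong) (auto simp: indicator_def)
  also have "\<dots> = (\<Sum>t\<in>{1..u} \<inter> S. real (s t))" by (simp add: sum.inter_restrict)
  finally show ?thesis using assms by (simp add: Int_absorb1)
qed

lemma od_eval_indicator: "od_eval (indicator S) e \<in> {-1, 0, 1}"
  by (auto simp: od_eval_def indicator_def sgn_if)

text \<open>
  Column \<open>y * m + i\<close> with \<open>i < m\<close> is the point \<open>(y, i)\<close>, and the \<open>m\<close> rows with quotient \<open>x\<close>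
  modulo \<open>m\<close> are supported on the \<open>x\<close>-th line of a parallel class. \<open>meet\<close> says that lines from
  different classes share at most one point, \<open>transversal\<close> that a line has at most one point
  in each group \<open>{y} \<times> {..<m}\<close>.
\<close>
locale line_frames =
  fixes m q k :: nat and A :: "nat \<Rightarrow> nat \<Rightarrow> nat \<Rightarrow> int"
  assumes k: "k > 0"
    and entries: "a < m \<Longrightarrow> \<rho> < m * q \<Longrightarrow> \<tau> < m * q \<Longrightarrow> A a \<rho> \<tau> \<in> {-1, 0, 1}"
    and orth: "a < m \<Longrightarrow> \<rho> < m * q \<Longrightarrow> \<sigma> < m * q \<Longrightarrow>
      (\<Sum>\<tau><m * q. A a \<rho> \<tau> * A a \<sigma> \<tau>) = (if \<rho> = \<sigma> then int k else 0)"
    and meet: "a < m \<Longrightarrow> b < m \<Longrightarrow> a \<noteq> b \<Longrightarrow> \<rho> < m * q \<Longrightarrow> \<rho>' < m * q \<Longrightarrow> \<sigma> < m * q \<Longrightarrow> \<sigma>' < m * q \<Longrightarrow>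
      \<tau> < m * q \<Longrightarrow> \<tau>' < m * q \<Longrightarrow> \<rho> div m = \<rho>' div m \<Longrightarrow> \<sigma> div m = \<sigma>' div m \<Longrightarrow>
      A a \<rho> \<tau> \<noteq> 0 \<Longrightarrow> A b \<sigma> \<tau> \<noteq> 0 \<Longrightarrow> A a \<rho>' \<tau>' \<noteq> 0 \<Longrightarrow> A b \<sigma>' \<tau>' \<noteq> 0 \<Longrightarrow> \<tau> = \<tau>'"
    and transversal: "a < m \<Longrightarrow> \<rho> < m * q \<Longrightarrow> y < q \<Longrightarrow> i < m \<Longrightarrow> j < m \<Longrightarrow>
      A a \<rho> (y * m + i) \<noteq> 0 \<Longrightarrow> A a \<rho> (y * m + j) \<noteq> 0 \<Longrightarrow> i = j"
begin

section \<open>Products of two frames\<close>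

definition V :: "nat \<Rightarrow> nat \<Rightarrow> nat \<Rightarrow> nat \<Rightarrow> int" where
  "V a b \<rho> \<sigma> = (\<Sum>\<tau><m * q. A a \<rho> \<tau> * A b \<sigma> \<tau>)"

text \<open>By \<open>meet\<close> the supports of the two rows share no point besides
  \<open>\<tau>\<close>, so one term of the sum survives.\<close>

lemma V_single:
  assumes "a < m" "b < m" "a \<noteq> b" "\<rho> < m * q" "\<sigma> < m * q" "\<tau> < m * q"
    and "A a \<rho> \<tau> \<noteq> 0" "A b \<sigma> \<tau> \<noteq> 0"
  shows "V a b \<rho> \<sigma> = A a \<rho> \<tau> * A b \<sigma> \<tau>"
proof -
  have "V a b \<rho> \<sigma> = (\<Sum>\<tau>'\<in>{\<tau>}. A a \<rho> \<tau>' * A b \<sigma> \<tau>')"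
    unfolding V_def
  proof (rule sum.mono_neutral_right)
    show "\<forall>i\<in>{..<m * q} - {\<tau>}. A a \<rho> i * A b \<sigma> i = 0"
      using meet[OF assms(1-3) assms(4,4,5,5,6) _ refl refl assms(7,8)] by auto
  qed (use assms in auto)
  then show ?thesis by simp
qed

lemma V_nonzero:
  assumes "V a b \<rho> \<sigma> \<noteq> 0"
  obtains \<tau> where "\<tau> < m * q" "A a \<rho> \<tau> \<noteq> 0" "A b \<sigma> \<tau> \<noteq> 0"
proof -
  from assms obtain \<tau> where "\<tau> \<in> {..<m * q}" "A a \<rho> \<tau> * A b \<sigma> \<tau> \<noteq> 0"
    unfolding V_def by (rule sum.not_neutral_contains_not_neutral)
  with that show thesis by auto
qed

lemma V_entries:
  assumes "a < m" "b < m" "a \<noteq> b" "\<rho> < m * q" "\<sigma> < m * q"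
  shows "V a b \<rho> \<sigma> \<in> {-1, 0, 1}"
proof (cases "V a b \<rho> \<sigma> = 0")
  case False
  then obtain \<tau> where \<tau>: "\<tau> < m * q" "A a \<rho> \<tau> \<noteq> 0" "A b \<sigma> \<tau> \<noteq> 0" by (rule V_nonzero)
  show ?thesis
    using V_single[OF assms \<tau>] entries[OF assms(1,4) \<tau>(1)] entries[OF assms(2,5) \<tau>(1)] by auto
qed simp

text \<open>
  Rows \<open>0\<close> and \<open>1\<close> belong to the same line in every class, so nonzero \<open>V a b 0 0\<close> and
  \<open>V a b 1 1\<close> come from the same point, which then makes \<open>V a b 0 1\<close> nonzero.
\<close>
lemma V_not_scalar:
  assumes "a < m" "b < m" "a \<noteq> b" "q > 0" "c \<noteq> 0"
  shows "\<exists>\<rho><m * q. \<exists>\<sigma><m * q. V a b \<rho> \<sigma> \<noteq> (if \<rho> = \<sigma> then c else 0)"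
proof (rule ccontr)
  assume "\<not> ?thesis"
  then have V: "V a b \<rho> \<sigma> = (if \<rho> = \<sigma> then c else 0)" if "\<rho> < m * q" "\<sigma> < m * q" for \<rho> \<sigma>
    using that by blast
  \<comment> \<open>Two different indices below \<open>m\<close> exist, so rows 0 and 1 both have
    quotient 0.\<close>
  have m: "1 < m" using assms by linarith
  have "m * 1 \<le> m * q" using assms by (intro mult_left_mono) auto
  then have less: "0 < m * q" "1 < m * q" using m by linarith+
  have "V a b 0 0 \<noteq> 0" "V a b 1 1 \<noteq> 0" using V[OF less(1,1)] V[OF less(2,2)] assms by auto
  then obtain \<tau> \<tau>' where \<tau>: "\<tau> < m * q" "A a 0 \<tau> \<noteq> 0" "A b 0 \<tau> \<noteq> 0"
    and \<tau>': "\<tau>' < m * q" "A a 1 \<tau>' \<noteq> 0" "A b 1 \<tau>' \<noteq> 0"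
    using V_nonzero by metis
  have "\<tau> = \<tau>'"
    using m by (intro meet[OF assms(1-3) less less \<tau>(1) \<tau>'(1) _ _ \<tau>(2,3) \<tau>'(2,3)]) auto
  then have "V a b 0 1 \<noteq> 0" using V_single[OF assms(1-3) less \<tau>(1,2)] \<tau>' \<tau> by simp
  then show False using V[OF less] by simp
qed

text \<open>The inner factor, the transpose of \<open>A b\<close> times \<open>A b\<close>, is
  \<open>k\<close> times the identity by \<open>gram_transpose\<close>; the outer product of
  \<open>A a\<close> with its transpose contributes the second factor \<open>k\<close>.\<close>

lemma V_gram:
  assumes "a < m" "b < m" "\<rho> < m * q" "\<sigma> < m * q"
  shows "(\<Sum>\<nu><m * q. V a b \<rho> \<nu> * V a b \<sigma> \<nu>) = (if \<rho> = \<sigma> then int (k ^ 2) else 0)"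
proof -
  let ?N = "m * q"
  have gram: "(\<Sum>\<nu><?N. A b \<nu> \<tau> * A b \<nu> \<tau>') = (if \<tau> = \<tau>' then int k else 0)"
    if "\<tau> < ?N" "\<tau>' < ?N" for \<tau> \<tau>'
    by (rule gram_transpose[OF orth[OF assms(2)]]) (use k that in auto)
  have "(\<Sum>\<nu><?N. V a b \<rho> \<nu> * V a b \<sigma> \<nu>)
      = (\<Sum>\<nu><?N. \<Sum>\<tau><?N. \<Sum>\<tau>'<?N. A a \<rho> \<tau> * A a \<sigma> \<tau>' * (A b \<nu> \<tau> * A b \<nu> \<tau>'))"
    unfolding V_def sum_product by (simp add: mult_ac)
  also have "\<dots> = (\<Sum>\<tau><?N. \<Sum>\<nu><?N. \<Sum>\<tau>'<?N. A a \<rho> \<tau> * A a \<sigma> \<tau>' * (A b \<nu> \<tau> * A b \<nu> \<tau>'))"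
    by (rule sum.swap)
  also have "\<dots> = (\<Sum>\<tau><?N. \<Sum>\<tau>'<?N. \<Sum>\<nu><?N. A a \<rho> \<tau> * A a \<sigma> \<tau>' * (A b \<nu> \<tau> * A b \<nu> \<tau>'))"
    by (intro sum.cong refl sum.swap)
  also have "\<dots> = (\<Sum>\<tau><?N. \<Sum>\<tau>'<?N. A a \<rho> \<tau> * A a \<sigma> \<tau>' * (if \<tau> = \<tau>' then int k else 0))"
    unfolding sum_distrib_left[symmetric]
    by (intro sum.cong refl arg_cong2[where f = "(*)"] gram) auto
  also have "\<dots> = (\<Sum>\<tau><?N. A a \<rho> \<tau> * A a \<sigma> \<tau> * int k)"
    by (simp add: if_distrib[where f = "\<lambda>z. _ * z"] cong: if_cong)
  also have "\<dots> = (if \<rho> = \<sigma> then int (k ^ 2) else 0)"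
    by (simp add: sum_distrib_right[symmetric] orth assms power2_eq_square)
  finally show ?thesis .
qed

section \<open>Symbolic designs and their evaluations\<close>

text \<open>The product \<open>A a * (I \<otimes> D)\<close> computed on integer codes. Adding codes
  is meaningful because \<open>transversal\<close> leaves at most one nonzero term.\<close>

definition design :: "(nat \<Rightarrow> nat \<Rightarrow> int) \<Rightarrow> nat \<Rightarrow> nat \<Rightarrow> nat \<Rightarrow> int" where
  "design D a \<rho> \<gamma> = (\<Sum>i<m. A a \<rho> (\<gamma> div m * m + i) * D i (\<gamma> mod m))"

text \<open>A line misses the group of \<open>y\<close> or meets it in a single point, so an entry
  is 0 or a signed entry of \<open>D\<close>.\<close>

lemma design_cases:
  assumes "a < m" "\<rho> < m * q" "y < q" "c < m"
  obtains "\<forall>i<m. A a \<rho> (y * m + i) = 0" "design D a \<rho> (y * m + c) = 0"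
  | i where "i < m" "\<forall>j<m. j \<noteq> i \<longrightarrow> A a \<rho> (y * m + j) = 0"
    "A a \<rho> (y * m + i) \<in> {-1, 0, 1}" "design D a \<rho> (y * m + c) = A a \<rho> (y * m + i) * D i c"
proof -
  have dm: "(y * m + c) div m = y" "(y * m + c) mod m = c" using assms(4) by simp_all
  show ?thesis
  proof (cases "\<forall>i<m. A a \<rho> (y * m + i) = 0")
  case True
  then show ?thesis using that(1) by (simp add: design_def dm)
next
  case False
  then obtain i where i: "i < m" "A a \<rho> (y * m + i) \<noteq> 0" by auto
  then have 0: "\<forall>j<m. j \<noteq> i \<longrightarrow> A a \<rho> (y * m + j) = 0"
    using transversal[OF assms(1-3)] by blast
  have "design D a \<rho> (y * m + c) = (\<Sum>j\<in>{i}. A a \<rho> (y * m + j) * D j c)"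
    unfolding design_def dm using 0 i by (intro sum.mono_neutral_right) auto
  then show ?thesis
    using that(2)[OF i(1) 0] entries[OF assms(1,2) block_index_less[OF assms(3) i(1)]] by simp
  qed
qed

text \<open>Evaluation is not additive on codes, but it passes through a sum with at most one
  nonzero term.\<close>

lemma od_eval_design:
  assumes "a < m" "\<rho> < m * q" "y < q" "c < m"
  shows "od_eval x (design D a \<rho> (y * m + c)) = (\<Sum>i<m. of_int (A a \<rho> (y * m + i)) * od_eval x (D i c))"
  using assms
proof (cases rule: design_cases[where D = D])
  case 1
  then show ?thesis by simp
next
  case (2 i)
  have "(\<Sum>j<m. of_int (A a \<rho> (y * m + j)) * od_eval x (D j c))
      = (\<Sum>j\<in>{i}. of_int (A a \<rho> (y * m + j)) * od_eval x (D j c))"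
    using 2 by (intro sum.mono_neutral_right) auto
  with 2 show ?thesis by (simp add: od_eval_sign_mult)
qed

lemma design_bound:
  assumes "orthogonal_design m u s D" "a < m" "\<rho> < m * q" "\<gamma> < m * q"
  shows "nat \<bar>design D a \<rho> \<gamma>\<bar> \<le> u"
proof -
  have m: "m > 0" using assms by simp
  have y: "\<gamma> div m < q" "\<gamma> mod m < m"
    using assms m by (simp_all add: less_mult_imp_div_less mult.commute)
  have D: "nat \<bar>D i j\<bar> \<le> u" if "i < m" "j < m" for i j
    using assms(1) that by (simp add: orthogonal_design_def)
  from assms(2,3) y have "nat \<bar>design D a \<rho> (\<gamma> div m * m + \<gamma> mod m)\<bar> \<le> u"
  proof (cases rule: design_cases[where D = D])
    case (2 i)
    then show ?thesis using D[OF 2(1) y(2)] by (auto simp: abs_mult)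
  qed simp
  then show ?thesis by simp
qed

text \<open>Within each group the rows of \<open>D\<close> are orthogonal, so the form factors out
  and the frame products add up to \<open>V\<close>. The case \<open>a = b\<close> gives
  orthogonality, the other case unbiasedness.\<close>

lemma design_product:
  assumes D: "orthogonal_design m u s D" and "a < m" "b < m" "\<rho> < m * q" "\<sigma> < m * q"
  shows "(\<Sum>\<gamma><m * q. od_eval x (design D a \<rho> \<gamma>) * od_eval x (design D b \<sigma> \<gamma>))
    = od_form u s x * of_int (V a b \<rho> \<sigma>)"
proof -
  let ?a = "\<lambda>y i. of_int (A a \<rho> (y * m + i)) :: real"
  let ?b = "\<lambda>y i. of_int (A b \<sigma> (y * m + i)) :: real"
  let ?d = "\<lambda>i c. od_eval x (D i c)"
  have block: "(\<Sum>c<m. od_eval x (design D a \<rho> (y * m + c)) * od_eval x (design D b \<sigma> (y * m + c)))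
      = od_form u s x * (\<Sum>i<m. ?a y i * ?b y i)" if y: "y < q" for y
  proof -
    have "(\<Sum>c<m. od_eval x (design D a \<rho> (y * m + c)) * od_eval x (design D b \<sigma> (y * m + c)))
        = (\<Sum>c<m. \<Sum>i<m. \<Sum>j<m. ?a y i * ?b y j * (?d i c * ?d j c))"
      using od_eval_design[OF assms(2,4) y] od_eval_design[OF assms(3,5) y]
      by (intro sum.cong refl) (simp add: sum_product mult.assoc mult.left_commute)
    also have "\<dots> = (\<Sum>i<m. \<Sum>c<m. \<Sum>j<m. ?a y i * ?b y j * (?d i c * ?d j c))"
      by (rule sum.swap)
    also have "\<dots> = (\<Sum>i<m. \<Sum>j<m. \<Sum>c<m. ?a y i * ?b y j * (?d i c * ?d j c))"
      by (intro sum.cong refl sum.swap)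
    also have "\<dots> = (\<Sum>i<m. \<Sum>j<m. ?a y i * ?b y j * (if i = j then od_form u s x else 0))"
      unfolding sum_distrib_left[symmetric]
      by (intro sum.cong refl arg_cong2[where f = "(*)"])
        (use D in \<open>simp add: orthogonal_design_def\<close>)
    also have "\<dots> = (\<Sum>i<m. ?a y i * ?b y i * od_form u s x)"
      by (simp add: if_distrib[where f = "\<lambda>z. _ * z"] cong: if_cong)
    also have "\<dots> = od_form u s x * (\<Sum>i<m. ?a y i * ?b y i)"
      by (simp add: sum_distrib_left mult_ac)
    finally show ?thesis .
  qed
  show ?thesis
    unfolding V_def sum_blocks
    by (simp add: block sum_distrib_left[symmetric])
qed

lemma V_self: "a < m \<Longrightarrow> \<rho> < m * q \<Longrightarrow> \<sigma> < m * q \<Longrightarrow> V a a \<rho> \<sigma> = (if \<rho> = \<sigma> then int k else 0)"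
  unfolding V_def by (rule orth)

lemma orthogonal_design_design:
  assumes "orthogonal_design m u s D" "a < m"
  shows "orthogonal_design (m * q) u (\<lambda>i. k * s i) (design D a)"
  using assms
  by (auto simp: orthogonal_design_def[of "m * q"] design_bound design_product V_self od_form_scale)

text \<open>The type contributes a factor \<open>k\<close>, which the division by
  \<open>sqrt (k ^ 2)\<close> removes; the witness is therefore \<open>V\<close> itself.\<close>

lemma unbiased_od_design:
  assumes D: "orthogonal_design m u s D" and ab: "a < m" "b < m" "a \<noteq> b"
  shows "unbiased_od (m * q) u (\<lambda>i. k * s i) (real (k ^ 2)) (design D a) (design D b)"
  unfolding unbiased_od_def
proof (intro conjI exI[of _ "\<lambda>\<rho> \<sigma>. of_int (V a b \<rho> \<sigma>)"] allI impI)
  show "(of_int (V a b \<rho> \<sigma>) :: real) \<in> {-1, 0, 1}" if "\<rho> < m * q" "\<sigma> < m * q" for \<rho> \<sigma>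
    using V_entries[OF ab that] by auto
  show "(\<Sum>l<m * q. od_eval x (design D a i l) * od_eval x (design D b j l))
      = od_form u (\<lambda>i. k * s i) x / sqrt (real (k ^ 2)) * of_int (V a b i j)"
    if "i < m * q" "j < m * q" for x i j
    using k that ab by (simp add: design_product[OF D] od_form_scale real_sqrt_power)
qed (use D ab k in \<open>auto intro: orthogonal_design_design\<close>)

text \<open>Equal evaluations would make \<open>V a b\<close> equal to \<open>V a a\<close>, that is
  to \<open>k\<close> times the identity, against \<open>V_not_scalar\<close>.\<close>

lemma distinct_mat_eval_design:
  assumes D: "orthogonal_design m u s D" and ab: "a < m" "b < m" "a \<noteq> b"
    and q: "q > 0" and x: "od_form u s x \<noteq> 0"
  shows "distinct_mat (m * q) (\<lambda>i j. od_eval x (design D a i j)) (\<lambda>i j. od_eval x (design D b i j))"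
proof (rule ccontr)
  assume "\<not> ?thesis"
  then have eq: "od_eval x (design D a i j) = od_eval x (design D b i j)" if "i < m * q" "j < m * q" for i j
    using that by (auto simp: distinct_mat_def)
  have "V a b \<rho> \<sigma> = (if \<rho> = \<sigma> then int k else 0)" if "\<rho> < m * q" "\<sigma> < m * q" for \<rho> \<sigma>
  proof -
    have "od_form u s x * of_int (V a b \<rho> \<sigma>) = od_form u s x * of_int (V a a \<rho> \<sigma>)"
      unfolding design_product[OF D ab(1,2) that, symmetric] design_product[OF D ab(1,1) that, symmetric]
      by (intro sum.cong) (auto simp: eq that)
    then show ?thesis using x V_self[OF ab(1) that] by simp
  qed
  then show False using V_not_scalar[OF ab q, of "int k"] k by auto
qed

text \<open>Setting the variables in \<open>S\<close> to 1 and the others to 0 turns the form into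
  the sum of \<open>s\<close> over \<open>S\<close>.\<close>

lemma weighing_matrix_eval_design:
  assumes D: "orthogonal_design m u s D" and "a < m" and S: "S \<subseteq> {1..u}"
  shows "weighing_matrix (m * q) (k * (\<Sum>i\<in>S. s i)) (\<lambda>i j. od_eval (indicator S) (design D a i j))"
  unfolding weighing_matrix_def
  using od_eval_indicator assms(2)
  by (simp add: design_product[OF D] V_self od_form_indicator[OF S] mult.commute)

text \<open>The square root equals the value of the form at the indicator of \<open>S\<close>, so
  the quotient is \<open>V\<close>, and \<open>V_gram\<close> gives its weight.\<close>

lemma quasi_unbiased_eval_design:
  assumes D: "orthogonal_design m u s D" and ab: "a < m" "b < m" "a \<noteq> b" and S: "S \<subseteq> {1..u}"
    and pos: "(\<Sum>i\<in>S. s i) > 0"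
  shows "quasi_unbiased (m * q) (k * (\<Sum>i\<in>S. s i)) (k ^ 2) (real ((\<Sum>i\<in>S. s i) ^ 2))
    (\<lambda>i j. od_eval (indicator S) (design D a i j)) (\<lambda>i j. od_eval (indicator S) (design D b i j))"
proof -
  let ?P = "\<lambda>i j. (\<Sum>t<m * q. od_eval (indicator S) (design D a i t) * od_eval (indicator S) (design D b j t))
    / sqrt (real ((\<Sum>i\<in>S. s i) ^ 2))"
  have P: "?P i j = of_int (V a b i j)" if "i < m * q" "j < m * q" for i j
    unfolding design_product[OF D ab(1,2) that] od_form_indicator[OF S] of_nat_power real_sqrt_abs
    using pos by (simp del: of_nat_sum)
  have "weighing_matrix (m * q) (k ^ 2) ?P"
    unfolding weighing_matrix_def
  proof (intro conjI allI impI)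
    fix i j assume ij: "i < m * q" "j < m * q"
    show "?P i j \<in> {-1, 0, 1}" using V_entries[OF ab ij] unfolding P[OF ij] by auto
    have "(\<Sum>l<m * q. ?P i l * ?P j l) = of_int (\<Sum>l<m * q. V a b i l * V a b j l)"
      unfolding of_int_sum of_int_mult
    proof (intro sum.cong refl)
      fix l assume "l \<in> {..<m * q}"
      then have l: "l < m * q" by simp
      show "?P i l * ?P j l = of_int (V a b i l) * of_int (V a b j l)"
        unfolding P[OF ij(1) l] P[OF ij(2) l] ..
    qed
    then show "(\<Sum>l<m * q. ?P i l * ?P j l) = (if i = j then real (k ^ 2) else 0)"
      unfolding V_gram[OF ab(1,2) ij] by simp
  qed
  then show ?thesis
    unfolding quasi_unbiased_def using weighing_matrix_eval_design[OF D _ S] ab by blast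
qed

end

text \<open>
  The classes are the slopes \<open>1, \<dots>, m\<close> if \<open>m < q\<close>. If \<open>m = q\<close>, only \<open>q - 1\<close> nonzero slopes are
  available, but the groups of constant \<open>i\<close> then have size \<open>m\<close> and form the missing class.
\<close>
lemma line_frames_exist:
  assumes "prime_power q" and m: "m > 0" and k: "k > 0" and mq: "m \<le> q" and W: "weighing_matrix m k W"
  obtains A where "line_frames m q k A"
proof -
  obtain h :: "nat \<Rightarrow> nat \<Rightarrow> nat \<Rightarrow> nat"
  where bij: "\<And>a i. a < q \<Longrightarrow> i < q \<Longrightarrow> bij_betw (h a i) {..<q} {..<q}"
    and inj: "\<And>a i j x. 0 < a \<Longrightarrow> a < q \<Longrightarrow> i < q \<Longrightarrow> j < q \<Longrightarrow> x < q \<Longrightarrow> h a i x = h a j x \<Longrightarrow> i = j"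
    and meet: "\<And>a b i j x y. a < q \<Longrightarrow> b < q \<Longrightarrow> i < q \<Longrightarrow> j < q \<Longrightarrow> x < q \<Longrightarrow> y < q \<Longrightarrow> a \<noteq> b \<Longrightarrow>
      h a i x = h b i y \<Longrightarrow> h a j x = h b j y \<Longrightarrow> i = j"
    by (rule finite_field_lines[OF assms(1)]) (rule that; assumption)
  \<comment> \<open>The integer version of \<open>W\<close>; the floor is exact on entries -1, 0,
    1.\<close>
  define w where "w i j = \<lfloor>W i j\<rfloor>" for i j
  have w: "w i j \<in> {-1, 0, 1}" "of_int (w i j) = W i j" if "i < m" "j < m" for i j
  proof -
    have "W i j \<in> {-1, 0, 1}" using W that by (simp add: weighing_matrix_def)
    then have "W i j = of_int (-1) \<or> W i j = of_int 0 \<or> W i j = of_int 1" by simp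
    then show "w i j \<in> {-1, 0, 1}" "of_int (w i j) = W i j"
      unfolding w_def by (metis floor_of_int insertCI)+
  qed
  have ww: "(\<Sum>l<m. w i l * w j l) = (if i = j then int k else 0)" if "i < m" "j < m" for i j
  proof -
    have "real_of_int (\<Sum>l<m. w i l * w j l) = (\<Sum>l<m. W i l * W j l)"
      unfolding of_int_sum of_int_mult using that by (intro sum.cong) (auto simp: w)
    also have "\<dots> = real_of_int (if i = j then int k else 0)"
      using W that by (simp add: weighing_matrix_def)
    finally show ?thesis by (simp only: of_int_eq_iff)
  qed
  have dm: "t div m < q" "t mod m < m" "t mod m < q" if "t < m * q" for t
    using that m mod_less_divisor[OF m, of t] mq
    by (simp_all add: less_mult_imp_div_less mult.commute del: mod_less_divisor)
  have div_mod_eq: "s = t" if "s div m = t div m" "s mod m = t mod m" for s t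
    using that by (metis div_mult_mod_eq)
  \<comment> \<open>Row \<open>\<rho>\<close> carries row \<open>\<rho> mod m\<close> of
    \<open>w\<close> on line \<open>\<rho> div m\<close>; both kinds of parallel class reduce to
    this sum.\<close>
  have rows: "(\<Sum>l<m. if \<rho> div m = \<sigma> div m then w (\<rho> mod m) l * w (\<sigma> mod m) l else 0)
      = (if \<rho> = \<sigma> then int k else 0)" if "\<rho> < m * q" "\<sigma> < m * q" for \<rho> \<sigma>
  proof (cases "\<rho> div m = \<sigma> div m")
    case True
    then have "\<rho> = \<sigma> \<longleftrightarrow> \<rho> mod m = \<sigma> mod m" using div_mod_eq by blast
    then show ?thesis using True ww[OF dm(2)[OF that(1)] dm(2)[OF that(2)]] by simp
  next
    case False
    then have "\<rho> \<noteq> \<sigma>" by blast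
    then show ?thesis using False by simp
  qed
  \<comment> \<open>The class of slope \<open>c\<close>: the abscissa \<open>\<tau> mod m\<close> of
    a point on the line selects the column of \<open>w\<close>.\<close>
  define B where "B c \<rho> \<tau> = (if \<tau> div m = h c (\<tau> mod m) (\<rho> div m) then w (\<rho> mod m) (\<tau> mod m) else 0)"
    for c \<rho> \<tau>
  \<comment> \<open>The class of vertical lines: the height \<open>\<tau> div m\<close> selects the
    column of \<open>w\<close>, which fits when \<open>m = q\<close>.\<close>
  define B' where "B' \<rho> \<tau> = (if \<tau> mod m = \<rho> div m then w (\<rho> mod m) (\<tau> div m) else 0)" for \<rho> \<tau>
  have B_line: "\<tau> div m = h c (\<tau> mod m) (\<rho> div m)" if "B c \<rho> \<tau> \<noteq> 0" for c \<rho> \<tau>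
    using that by (simp add: B_def split: if_splits)
  have B'_line: "\<tau> mod m = \<rho> div m" if "B' \<rho> \<tau> \<noteq> 0" for \<rho> \<tau>
    using that by (simp add: B'_def split: if_splits)
  have B_orth: "(\<Sum>\<tau><m * q. B c \<rho> \<tau> * B c \<sigma> \<tau>) = (if \<rho> = \<sigma> then int k else 0)"
    if c: "c < q" and \<rho>: "\<rho> < m * q" and \<sigma>: "\<sigma> < m * q" for c \<rho> \<sigma>
  proof -
    let ?w = "\<lambda>i. w (\<rho> mod m) i * w (\<sigma> mod m) i"
    have eq: "h c i (\<rho> div m) = h c i (\<sigma> div m) \<longleftrightarrow> \<rho> div m = \<sigma> div m"
      and less: "h c i (\<rho> div m) < q" if "i < m" for i
    proof -
      have b: "bij_betw (h c i) {..<q} {..<q}" using bij[OF c] that mq by simp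
      show "h c i (\<rho> div m) = h c i (\<sigma> div m) \<longleftrightarrow> \<rho> div m = \<sigma> div m"
        using dm(1)[OF \<rho>] dm(1)[OF \<sigma>] by (intro inj_on_eq_iff[OF bij_betw_imp_inj_on[OF b]]) simp_all
      show "h c i (\<rho> div m) < q" using bij_betwE[OF b] dm(1)[OF \<rho>] by blast
    qed
    have "(\<Sum>\<tau><m * q. B c \<rho> \<tau> * B c \<sigma> \<tau>)
        = (\<Sum>y<q. \<Sum>i<m. if y = h c i (\<rho> div m) then if \<rho> div m = \<sigma> div m then ?w i else 0 else 0)"
      unfolding sum_blocks by (intro sum.cong refl) (auto simp: B_def eq)
    \<comment> \<open>For each abscissa \<open>i\<close> exactly one height below \<open>q\<close>
      lies on the line.\<close>
    also have "\<dots> = (\<Sum>i<m. \<Sum>y<q. if y = h c i (\<rho> div m) then if \<rho> div m = \<sigma> div m then ?w i else 0 else 0)"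
      by (rule sum.swap)
    also have "\<dots> = (\<Sum>i<m. if \<rho> div m = \<sigma> div m then ?w i else 0)"
      using less by (intro sum.cong refl) simp
    also have "\<dots> = (if \<rho> = \<sigma> then int k else 0)"
      by (rule rows[OF \<rho> \<sigma>])
    finally show ?thesis .
  qed
  have B'_orth: "(\<Sum>\<tau><m * q. B' \<rho> \<tau> * B' \<sigma> \<tau>) = (if \<rho> = \<sigma> then int k else 0)"
    if "m = q" and \<rho>: "\<rho> < m * q" and \<sigma>: "\<sigma> < m * q" for \<rho> \<sigma>
  proof -
    let ?w = "\<lambda>y. w (\<rho> mod m) y * w (\<sigma> mod m) y"
    have "(\<Sum>\<tau><m * q. B' \<rho> \<tau> * B' \<sigma> \<tau>)
        = (\<Sum>y<q. \<Sum>i<m. if i = \<rho> div m then if \<rho> div m = \<sigma> div m then ?w y else 0 else 0)"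
      unfolding sum_blocks
    proof (intro sum.cong refl)
      fix y i assume "i \<in> {..<m}"
      then have "(y * m + i) div m = y" "(y * m + i) mod m = i" by simp_all
      then show "B' \<rho> (y * m + i) * B' \<sigma> (y * m + i)
          = (if i = \<rho> div m then if \<rho> div m = \<sigma> div m then ?w y else 0 else 0)"
        unfolding B'_def by (cases "i = \<rho> div m"; cases "\<rho> div m = \<sigma> div m") simp_all
    qed
    also have "\<dots> = (\<Sum>y<m. if \<rho> div m = \<sigma> div m then ?w y else 0)"
      using dm[OF \<rho>] \<open>m = q\<close> by (intro sum.cong) simp_all
    also have "\<dots> = (if \<rho> = \<sigma> then int k else 0)"
      by (rule rows[OF \<rho> \<sigma>])
    finally show ?thesis .
  qed
  have B_meet: "\<tau> = \<tau>'"
    if "c < q" "d < q" "c \<noteq> d" and \<rho>: "\<rho> < m * q" and \<sigma>: "\<sigma> < m * q" and \<tau>: "\<tau> < m * q" "\<tau>' < m * q"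
      and eq: "\<rho> div m = \<rho>' div m" "\<sigma> div m = \<sigma>' div m"
      and nz: "B c \<rho> \<tau> \<noteq> 0" "B d \<sigma> \<tau> \<noteq> 0" "B c \<rho>' \<tau>' \<noteq> 0" "B d \<sigma>' \<tau>' \<noteq> 0"
    for c d \<rho> \<sigma> \<rho>' \<sigma>' \<tau> \<tau>'
  proof -
    have *: "\<tau> div m = h c (\<tau> mod m) (\<rho> div m)" "\<tau> div m = h d (\<tau> mod m) (\<sigma> div m)"
      "\<tau>' div m = h c (\<tau>' mod m) (\<rho> div m)" "\<tau>' div m = h d (\<tau>' mod m) (\<sigma> div m)"
      using nz[THEN B_line] unfolding eq .
    \<comment> \<open>Both points lie on the same two lines of different slopes, which agree at one
      abscissa only.\<close>
    have "\<tau> mod m = \<tau>' mod m"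
      by (rule meet[OF that(1,2) dm(3)[OF \<tau>(1)] dm(3)[OF \<tau>(2)] dm(1)[OF \<rho>] dm(1)[OF \<sigma>] that(3)
        trans[OF *(1)[symmetric] *(2)] trans[OF *(3)[symmetric] *(4)]])
    moreover from this have "\<tau> div m = \<tau>' div m" using *(1,3) by (simp only:)
    ultimately show ?thesis by (rule div_mod_eq[rotated])
  qed
  \<comment> \<open>The vertical line fixes the abscissa, and the line of slope \<open>d\<close>
    then fixes the height.\<close>
  have B'_meet: "\<tau> = \<tau>'"
    if "\<rho> div m = \<rho>' div m" "\<sigma> div m = \<sigma>' div m"
      "B' \<rho> \<tau> \<noteq> 0" "B d \<sigma> \<tau> \<noteq> 0" "B' \<rho>' \<tau>' \<noteq> 0" "B d \<sigma>' \<tau>' \<noteq> 0"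
    for d \<rho> \<sigma> \<rho>' \<sigma>' \<tau> \<tau>'
  proof (rule div_mod_eq)
    have "\<tau> mod m = \<rho> div m" using that(3) by (rule B'_line)
    also have "\<dots> = \<tau>' mod m" unfolding that(1) using that(5) by (rule B'_line[symmetric])
    finally show mod: "\<tau> mod m = \<tau>' mod m" .
    have "\<tau> div m = h d (\<tau> mod m) (\<sigma> div m)" using that(4) by (rule B_line)
    also have "\<dots> = \<tau>' div m" unfolding mod that(2) using that(6) by (rule B_line[symmetric])
    finally show "\<tau> div m = \<tau>' div m" .
  qed
  \<comment> \<open>A nonzero slope matters here: a horizontal line stays inside one group.\<close>
  have B_transversal: "i = j"
    if "0 < c" "c < q" "\<rho> < m * q" "i < m" "j < m" "B c \<rho> (y * m + i) \<noteq> 0" "B c \<rho> (y * m + j) \<noteq> 0"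
    for c \<rho> y i j
  proof (rule inj[OF that(1,2) _ _ dm(1)[OF that(3)]])
    show "h c i (\<rho> div m) = h c j (\<rho> div m)"
      using B_line[OF that(6)] B_line[OF that(7)] that(4,5) by simp
  qed (use that mq in simp_all)
  have B'_transversal: "i = j"
    if "i < m" "j < m" "B' \<rho> (y * m + i) \<noteq> 0" "B' \<rho> (y * m + j) \<noteq> 0" for \<rho> y i j
    using B'_line[OF that(3)] B'_line[OF that(4)] that(1,2) by simp
  \<comment> \<open>\<open>Suc a\<close> skips slope 0 and stays at most \<open>m < q\<close>. For
    \<open>m = q\<close> index 0 goes to the vertical class and the others are their own
    slopes.\<close>
  define A where "A a = (if m < q then B (Suc a) else if a = 0 then B' else B a)" for a
  show thesis
  proof (rule that[of A], cases "m < q")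
    case True
    then have A: "A = (\<lambda>a. B (Suc a))" by (simp add: A_def fun_eq_iff)
    show "line_frames m q k A"
    proof
      show "A a \<rho> \<tau> \<in> {-1, 0, 1}" if "\<rho> < m * q" "\<tau> < m * q" for a \<rho> \<tau>
        using w(1)[OF dm(2)[OF that(1)] dm(2)[OF that(2)]] by (auto simp: A B_def)
      show "(\<Sum>\<tau><m * q. A a \<rho> \<tau> * A a \<sigma> \<tau>) = (if \<rho> = \<sigma> then int k else 0)"
        if "a < m" "\<rho> < m * q" "\<sigma> < m * q" for a \<rho> \<sigma>
        unfolding A using that True by (intro B_orth) simp_all
      show "i = j" if "a < m" "\<rho> < m * q" "y < q" "i < m" "j < m"
        "A a \<rho> (y * m + i) \<noteq> 0" "A a \<rho> (y * m + j) \<noteq> 0" for a \<rho> y i j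
        using that True unfolding A by (intro B_transversal[of "Suc a" \<rho> i j y]) simp_all
      show "\<tau> = \<tau>'" if "a < m" "b < m" "a \<noteq> b" "\<rho> < m * q" "\<rho>' < m * q" "\<sigma> < m * q" "\<sigma>' < m * q"
        "\<tau> < m * q" "\<tau>' < m * q" "\<rho> div m = \<rho>' div m" "\<sigma> div m = \<sigma>' div m"
        "A a \<rho> \<tau> \<noteq> 0" "A b \<sigma> \<tau> \<noteq> 0" "A a \<rho>' \<tau>' \<noteq> 0" "A b \<sigma>' \<tau>' \<noteq> 0" for a b \<rho> \<rho>' \<sigma> \<sigma>' \<tau> \<tau>'
        by (rule B_meet[OF _ _ _ that(4,6,8,9,10,11) that(12-15)[unfolded A]]) (use that(1-3) True in simp_all)
    qed (rule k)
  next
    case False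
    then have "m = q" using mq by simp
    have A: "A 0 = B'" "a > 0 \<Longrightarrow> A a = B a" for a using False by (auto simp: A_def fun_eq_iff)
    show "line_frames m q k A"
    proof
      show "A a \<rho> \<tau> \<in> {-1, 0, 1}" if "\<rho> < m * q" "\<tau> < m * q" for a \<rho> \<tau>
        using w(1)[OF dm(2)[OF that(1)] dm(2)[OF that(2)]]
          w(1)[OF dm(2)[OF that(1)], of "\<tau> div m"] dm(1)[OF that(2)] \<open>m = q\<close>
        by (cases "a = 0") (auto simp: A B_def B'_def)
      show "(\<Sum>\<tau><m * q. A a \<rho> \<tau> * A a \<sigma> \<tau>) = (if \<rho> = \<sigma> then int k else 0)"
        if "a < m" "\<rho> < m * q" "\<sigma> < m * q" for a \<rho> \<sigma>
        using that B_orth[of a \<rho> \<sigma>] B'_orth[of \<rho> \<sigma>] \<open>m = q\<close> by (cases "a = 0") (simp_all add: A)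
      show "i = j" if "a < m" "\<rho> < m * q" "y < q" "i < m" "j < m"
        "A a \<rho> (y * m + i) \<noteq> 0" "A a \<rho> (y * m + j) \<noteq> 0" for a \<rho> y i j
      proof (cases "a = 0")
        case True
        then show ?thesis using that by (intro B'_transversal[of i j \<rho> y]) (simp_all add: A)
      next
        case False
        then show ?thesis using that \<open>m = q\<close> by (intro B_transversal[of a \<rho> i j y]) (simp_all add: A)
      qed
      show "\<tau> = \<tau>'" if "a < m" "b < m" "a \<noteq> b" "\<rho> < m * q" "\<rho>' < m * q" "\<sigma> < m * q" "\<sigma>' < m * q"
        "\<tau> < m * q" "\<tau>' < m * q" "\<rho> div m = \<rho>' div m" "\<sigma> div m = \<sigma>' div m"
        "A a \<rho> \<tau> \<noteq> 0" "A b \<sigma> \<tau> \<noteq> 0" "A a \<rho>' \<tau>' \<noteq> 0" "A b \<sigma>' \<tau>' \<noteq> 0" for a b \<rho> \<rho>' \<sigma> \<sigma>' \<tau> \<tau>'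
      proof -
        consider "a = 0" "b > 0" | "a > 0" "b = 0" | "a > 0" "b > 0" using \<open>a \<noteq> b\<close> by auto
        then show ?thesis
        proof cases
          case 1
          then show ?thesis using that(12-15) by (intro B'_meet[OF that(10,11)]) (simp_all add: A)
        next
          case 2
          then show ?thesis using that(12-15) by (intro B'_meet[OF that(11,10)]) (simp_all add: A)
        next
          case 3
          then show ?thesis using that(1,2,12-15) \<open>m = q\<close>
            by (intro B_meet[OF _ _ that(3,4,6,8,9,10,11)]) (simp_all add: A)
        qed
      qed
    qed (rule k)
  qed
qed

section \<open>Both families from one system of frames\<close>

theorem theorem4p8:
  fixes q m k u :: nat and s :: "nat \<Rightarrow> nat"
  assumes "q > 0" "m > 0" "k > 0" "u > 0" "\<forall>i\<in>{1..u}. s i > 0"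
    and "prime_power q" and "m \<le> q"
    and "\<exists>W. weighing_matrix m k W"
    and "\<exists>D. orthogonal_design m u s D"
  shows "(\<exists>Ds :: nat \<Rightarrow> nat \<Rightarrow> nat \<Rightarrow> int.
            (\<forall>a<m. orthogonal_design (m * q) u (\<lambda>i. k * s i) (Ds a)) \<and>
            (\<forall>a<m. \<forall>b<m. a \<noteq> b \<longrightarrow>
               distinct_mat (m * q) (Ds a) (Ds b) \<and>
               unbiased_od (m * q) u (\<lambda>i. k * s i) (real (k ^ 2)) (Ds a) (Ds b)))
       \<and> (\<forall>S. S \<noteq> {} \<and> S \<subseteq> {1..u} \<longrightarrow>
            (\<exists>Ws :: nat \<Rightarrow> nat \<Rightarrow> nat \<Rightarrow> real.
               (\<forall>a<m. weighing_matrix (m * q) (k * (\<Sum>i\<in>S. s i)) (Ws a)) \<and>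
               (\<forall>a<m. \<forall>b<m. a \<noteq> b \<longrightarrow>
                  distinct_mat (m * q) (Ws a) (Ws b) \<and>
                  quasi_unbiased (m * q) (k * (\<Sum>i\<in>S. s i)) (k ^ 2)
                    (real ((\<Sum>i\<in>S. s i) ^ 2)) (Ws a) (Ws b))))"
proof -
  obtain W where W: "weighing_matrix m k W" using assms by blast
  obtain D where D: "orthogonal_design m u s D" using assms by blast
  obtain A where "line_frames m q k A"
    using line_frames_exist[OF assms(6,2,3,7) W] by blast
  then interpret line_frames m q k A .
  have pos: "(\<Sum>i\<in>S. s i) > 0" if "S \<noteq> {}" "S \<subseteq> {1..u}" for S
  proof (rule sum_pos)
    show "s i > 0" if "i \<in> S" for i using assms(5) \<open>S \<subseteq> {1..u}\<close> that by blast
  qed (use that finite_subset in auto)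
  have distinct: "distinct_mat (m * q) (\<lambda>i j. od_eval (indicator S) (design D a i j))
      (\<lambda>i j. od_eval (indicator S) (design D b i j))"
    if "S \<noteq> {}" "S \<subseteq> {1..u}" "a < m" "b < m" "a \<noteq> b" for S a b
    using pos[OF that(1,2)] assms(1)
    by (intro distinct_mat_eval_design[OF D that(3-5)]) (simp_all add: od_form_indicator[OF that(2)] del: of_nat_sum)
  show ?thesis
  proof (intro conjI allI impI)
    \<comment> \<open>Evaluating all variables at 1 already separates the designs;
      \<open>u > 0\<close> makes this index set nonempty.\<close>
    have "distinct_mat (m * q) (design D a) (design D b)" if "a < m" "b < m" "a \<noteq> b" for a b
      using distinct[of "{1..u}" a b] that \<open>u > 0\<close> unfolding distinct_mat_def by fastforce
    then show "\<exists>Ds. (\<forall>a<m. orthogonal_design (m * q) u (\<lambda>i. k * s i) (Ds a)) \<and>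
        (\<forall>a<m. \<forall>b<m. a \<noteq> b \<longrightarrow> distinct_mat (m * q) (Ds a) (Ds b) \<and>
          unbiased_od (m * q) u (\<lambda>i. k * s i) (real (k ^ 2)) (Ds a) (Ds b))"
      using orthogonal_design_design[OF D] unbiased_od_design[OF D]
      by (intro exI[of _ "design D"]) blast
  next
    fix S assume S: "S \<noteq> {} \<and> S \<subseteq> {1..u}"
    show "\<exists>Ws. (\<forall>a<m. weighing_matrix (m * q) (k * (\<Sum>i\<in>S. s i)) (Ws a)) \<and>
        (\<forall>a<m. \<forall>b<m. a \<noteq> b \<longrightarrow> distinct_mat (m * q) (Ws a) (Ws b) \<and>
          quasi_unbiased (m * q) (k * (\<Sum>i\<in>S. s i)) (k ^ 2) (real ((\<Sum>i\<in>S. s i) ^ 2)) (Ws a) (Ws b))"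
      by (intro exI[of _ "\<lambda>a i j. od_eval (indicator S) (design D a i j)"] conjI allI impI
          weighing_matrix_eval_design[OF D] distinct quasi_unbiased_eval_design[OF D] pos)
        (use S in auto)
  qed
qed

end
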